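(* Suppose that the following weak inf-sup condition holds, with constants $\eta>0$, $\epsilon>0$ that do not depend on the mesh size or the physical parameters: $$\sup_{0\ne\mathbf w_h\in\mathbf V_h}\frac{(q,\operatorname{div}\mathbf w_h)}{\|\mathbf w_h\|_A}\ \ge\ \frac{\eta}{\sqrt{\lambda+2\mu/d}}\|q\|-\frac{\epsilon}{\sqrt{\lambda+2\mu/d}}\,h\|\nabla q\|\qquad\forall q\in Q_h.$$ Then the two-parameter iterative method (Steps 1 and 2 of the context) is convergent for any parameters $\gamma_1\in(1/2,2]$, $\gamma_1>\gamma_2\ge0$, and $L$ such that $(\gamma_1-\gamma_2)L=\omega\,\frac{\alpha^2}{\lambda+2\mu/d}\ge\frac{\alpha^2}{\lambda+2\mu/d}$, i.e. $\omega\ge1$. Additionally, for every iteration $i\ge1$, $$\|e_p^i\|^2+\frac{|1-\gamma_1|}{\gamma_1-\gamma_2}\|e_p^i\|_Z^2\ \le\ \frac{1}{1+\frac{\eta^2}{\omega(1+2\theta^* )}}\left(\|e_p^{i-1}\|^2+\frac{|1-\gamma_1|}{\gamma_1-\gamma_2}\|e_p^{i-1}\|_Z^2\right),$$ where $\theta^*\ge\frac{\epsilon^2C_2\gamma_1}{4\omega(\gamma_1-|1-\gamma_1|)}$ is a root of the quadratic equation $$\left[\frac{2(\gamma_1-|1-\gamma_1|)}{\gamma_1}\right]\theta^2+\left[\frac{\gamma_1-|1-\gamma_1|}{\gamma_1}-\frac{\eta^2|1-\gamma_1|}{2\omega\gamma_1}-\frac{\epsilon^2C_2}{2\omega}\right]\theta-\frac{\epsilon^2C_2}{4\omega}=0.$$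 Here $\eta$ is the constant in the weak inf-sup condition and $C_2$ is the constant in the upper bound of the spectral equivalence $C_1\|q\|_Z^2\le (h\|\nabla q\|)^2\le C_2\|q\|_Z^2$ for all $q\in Q_h$.
   Context: Let $\Omega\subset\mathbb R^d$, $d\le 3$, be a bounded domain with a simplicial partition $\mathcal T_h$; $h_T$ is the diameter of $T\in\mathcal T_h$. Parameters: Lamé constants $\lambda,\mu>0$, $\alpha>0$, $1/\beta\ge 0$, hydraulic conductivity $K>0$, time step $\tau>0$. $(\cdot,\cdot)$ and $\|\cdot\|$ are the $L^2(\Omega)$ inner product and norm. Spaces: $Q_h=\{q\in H^1_0(\Omega): q|_T\in P_1\ \forall T\in\mathcal T_h\}$; $\mathbf V_h\subset (H_0^1(\Omega))^d$ is either the space $\mathbf V_l$ of continuous piecewise linear vector fields vanishing on $\partial\Omega$, or the MINI-element space $\mathbf V_l\oplus\mathbf V_b$, where $\mathbf V_b$ is the space of vector-valued element bubble functions. Forms: $a(\mathbf u,\mathbf v)=2\mu\int_\Omega\varepsilon(\mathbf u):\varepsilon(\mathbf v)+\lambda\int_\Omega\operatorname{div}\mathbf u\operatorname{div}\mathbf v$ with $\varepsilon(\mathbf u)=\frac12(\nabla\mathbf u+\nabla\mathbf u^T)$; $a_p(p,q)=\int_\Omega K\nabla p\cdot\nabla q$; $\|\mathbf v\|_A^2=a(\mathbf v,\mathbf v)$. Lumped inner product: $(p,q)_0=\sum_{T}\frac{|T|}{d+1}\sum_{j=1}^{d+1}(pq)(P_{T,j})$, with $P_{T,j}$ the vertices of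 $T$. For $p,q\in Q_h$ set $(p,q)_Z=(p,q)_0-(p,q)$ and $\|q\|_Z^2=(q,q)_Z$ (which is nonnegative). The quantity $h\|\nabla q\|$ denotes $\big(\sum_{T}h_T^2\int_T|\nabla q|^2\big)^{1/2}$. Stabilized scheme: given $(\mathbf u_h^{n-1},p_h^{n-1})\in \mathbf V_h\times Q_h$ and data $\mathbf f_h^n,g_h^n$, the pair $(\mathbf u_h^n,p_h^n)\in\mathbf V_h\times Q_h$ solves, for all $\mathbf v_h\in\mathbf V_h$, $q_h\in Q_h$, with $\bar\partial_t p_h^n=(p_h^n-p_h^{n-1})/\tau$ and $\bar\partial_t\mathbf u_h^n=(\mathbf u_h^n-\mathbf u_h^{n-1})/\tau$, $$a(\mathbf u_h^n,\mathbf v_h)-\alpha(p_h^n,\operatorname{div}\mathbf v_h)=(\mathbf f_h^n,\mathbf v_h),$$ $$\tfrac1\beta(\bar\partial_tp_h^n,q_h)+\alpha(\operatorname{div}\bar\partial_t\mathbf u_h^n,q_h)+a_p(p_h^n,q_h)+L(\bar\partial_tp_h^n,q_h)_0-L(\bar\partial_tp_h^n,q_h)=(g_h^n,q_h).$$ Two-parameter iterative method for solving this scheme at time $t_n$, with parameters $\gamma_1,\gamma_2$: set $\mathbf u_h^{n,0}=\mathbf u_h^{n-1}$, $p_h^{n,0}=p_h^{n-1}$. For $i\ge1$: Step 1: find $p_h^{n,i}\in Q_h$ such that for all $q_h\in Q_h$ $$\tfrac1\beta\Big(\tfrac{p_h^{n,i}-p_h^{n-1}}\tau,q_h\Big)+\gamma_1L\Big(\tfrac{p_h^{n,i}-p_h^{n-1}}\tau,q_h\Big)_0-\gamma_2L\Big(\tfrac{p_h^{n,i}-p_h^{n-1}}\tau,q_h\Big)+a_p(p_h^{n,i},q_h)$$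 $$=(1-\gamma_2)L\Big(\tfrac{p_h^{n,i-1}-p_h^{n-1}}\tau,q_h\Big)+(\gamma_1-1)L\Big(\tfrac{p_h^{n,i-1}-p_h^{n-1}}\tau,q_h\Big)_0-\alpha\Big(\operatorname{div}\tfrac{\mathbf u_h^{n,i-1}-\mathbf u_h^{n-1}}\tau,q_h\Big)+(g_h^n,q_h).$$ Step 2: find $\mathbf u_h^{n,i}\in\mathbf V_h$ such that $a(\mathbf u_h^{n,i},\mathbf v_h)=\alpha(p_h^{n,i},\operatorname{div}\mathbf v_h)+(\mathbf f_h^n,\mathbf v_h)$ for all $\mathbf v_h\in\mathbf V_h$. Errors at iteration $i$: $e_{\mathbf u}^i=\mathbf u_h^{n,i}-\mathbf u_h^n$, $e_p^i=p_h^{n,i}-p_h^n$. Convergence means that these errors tend to zero as $i\to\infty$.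
   Formalization: The estimate at i=1 is stated only if the initial guess (u_h^{n-1}, p_h^{n-1}) satisfies the momentum equation with the current load f_h^n, since it can fail otherwise (e_p^0=0 but e_p^1≠0); for i≥2 and for convergence nothing is added. *)

theory Defs
  imports "HOL-Analysis.Analysis"
begin

definition L2_space :: "(real^'d::finite) set \<Rightarrow> (real^'d \<Rightarrow> 'b::euclidean_space) set" where
  "L2_space \<Omega> = {f. set_borel_measurable lebesgue \<Omega> f \<and>
                    set_integrable lebesgue \<Omega> (\<lambda>x. (norm (f x))\<^sup>2)}"

definition ip :: "(real^'d::finite) set \<Rightarrow> (real^'d \<Rightarrow> 'b::real_inner) \<Rightarrow> (real^'d \<Rightarrow> 'b) \<Rightarrow> real" where
  "ip \<Omega> f g = set_lebesgue_integral lebesgue \<Omega> (\<lambda>x. f x \<bullet> g x)"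

definition L2_norm :: "(real^'d::finite) set \<Rightarrow> (real^'d \<Rightarrow> 'b::real_inner) \<Rightarrow> real" where
  "L2_norm \<Omega> f = sqrt (ip \<Omega> f f)"

text \<open>
  The operators below are pointwise (classical) derivatives. They are applied to test functions and
  to continuous piecewise polynomials; the latter are differentiable off a null set, and there the
  classical and the weak derivatives agree almost everywhere.
\<close>

definition grad :: "(real^'d::finite \<Rightarrow> real) \<Rightarrow> real^'d \<Rightarrow> real^'d" where
  "grad q x = (\<chi> i. frechet_derivative q (at x) (axis i 1))"

definition strain :: "(real^'d::finite \<Rightarrow> real^'d) \<Rightarrow> real^'d \<Rightarrow> real^'d^'d" where
  "strain v x = (1/2) *\<^sub>R (jacobian v (at x) + transpose (jacobian v (at x)))"

definition divg :: "(real^'d::finite \<Rightarrow> real^'d) \<Rightarrow> real^'d \<Rightarrow> real" where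
  "divg v x = trace (jacobian v (at x))"

text \<open>
  Smoothness: \<open>D is\<close> is the iterated partial derivative of \<open>\<phi>\<close> with respect to the indices in the
  list \<open>is\<close>, and all of them are differentiable.
\<close>

definition smooth :: "(real^'d::finite \<Rightarrow> real) \<Rightarrow> bool" where
  "smooth \<phi> \<longleftrightarrow> (\<exists>D :: 'd list \<Rightarrow> real^'d \<Rightarrow> real. D [] = \<phi> \<and>
     (\<forall>is x. (D is has_derivative (\<lambda>h. \<Sum>i\<in>UNIV. h $ i * D (i # is) x)) (at x)))"

definition test_functions :: "(real^'d::finite) set \<Rightarrow> (real^'d \<Rightarrow> real) set" where
  "test_functions \<Omega> = {\<phi>. smooth \<phi> \<and> compact (closure {x. \<phi> x \<noteq> 0}) \<and> closure {x. \<phi> x \<noteq> 0} \<subseteq> \<Omega>}"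

definition has_weak_gradient ::
    "(real^'d::finite) set \<Rightarrow> (real^'d \<Rightarrow> real) \<Rightarrow> (real^'d \<Rightarrow> real^'d) \<Rightarrow> bool" where
  "has_weak_gradient \<Omega> u G \<longleftrightarrow>
     (\<forall>\<phi>\<in>test_functions \<Omega>. \<forall>i. ip \<Omega> u (\<lambda>x. grad \<phi> x $ i) = - ip \<Omega> (\<lambda>x. G x $ i) \<phi>)"

text \<open>The Sobolev space of functions vanishing on the boundary: the closure of the test functions in
  the \<open>H\<^sup>1\<close> norm.\<close>

definition H10 :: "(real^'d::finite) set \<Rightarrow> (real^'d \<Rightarrow> real) set" where
  "H10 \<Omega> = {u \<in> L2_space \<Omega>. \<exists>G\<in>L2_space \<Omega>. has_weak_gradient \<Omega> u G \<and>
     (\<exists>\<phi>. (\<forall>k::nat. \<phi> k \<in> test_functions \<Omega>) \<and>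
          (\<lambda>k. L2_norm \<Omega> (\<lambda>x. \<phi> k x - u x)) \<longlonglongrightarrow> 0 \<and>
          (\<lambda>k. L2_norm \<Omega> (\<lambda>x. grad (\<phi> k) x - G x)) \<longlonglongrightarrow> 0)}"

definition bounded_domain :: "(real^'d::finite) set \<Rightarrow> bool" where
  "bounded_domain \<Omega> \<longleftrightarrow> open \<Omega> \<and> connected \<Omega> \<and> bounded \<Omega> \<and> \<Omega> \<noteq> {}"

text \<open>The elements are closed simplices of full dimension; \<^const>\<open>triangulation\<close> says that they are
  finitely many and that any two of them meet in a common face.\<close>

definition simplicial_partition :: "(real^'d::finite) set \<Rightarrow> (real^'d) set set \<Rightarrow> bool" where
  "simplicial_partition \<Omega> \<T> \<longleftrightarrow>
     triangulation \<T> \<and> (\<forall>T\<in>\<T>. int CARD('d) simplex T) \<and> \<Union>\<T> = closure \<Omega>"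

definition vertices :: "(real^'d::finite) set \<Rightarrow> (real^'d) set" where
  "vertices T = {P. P extreme_point_of T}"

definition P1_on :: "(real^'d::finite) set \<Rightarrow> (real^'d \<Rightarrow> real) \<Rightarrow> bool" where
  "P1_on T q \<longleftrightarrow> (\<exists>c a. \<forall>x\<in>T. q x = c + a \<bullet> x)"

text \<open>
  A finite element function is represented by the function that is affine on every closed element
  (hence continuous, so that its nodal values make sense) and is extended by zero outside the closure
  of the domain, so that equal functions on the domain have equal representatives.
\<close>

definition Q_space :: "(real^'d::finite) set \<Rightarrow> (real^'d) set set \<Rightarrow> (real^'d \<Rightarrow> real) set" where
  "Q_space \<Omega> \<T> = {q \<in> H10 \<Omega>. (\<forall>T\<in>\<T>. P1_on T q) \<and> (\<forall>x. x \<notin> closure \<Omega> \<longrightarrow> q x = 0)}"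

definition V_linear :: "(real^'d::finite) set \<Rightarrow> (real^'d) set set \<Rightarrow> (real^'d \<Rightarrow> real^'d) set" where
  "V_linear \<Omega> \<T> = {v. continuous_on (closure \<Omega>) v \<and> (\<forall>T\<in>\<T>. \<forall>i. P1_on T (\<lambda>x. v x $ i)) \<and>
     (\<forall>x\<in>frontier \<Omega>. v x = 0) \<and> (\<forall>x. x \<notin> closure \<Omega> \<longrightarrow> v x = 0)}"

definition barycentric :: "(real^'d::finite) set \<Rightarrow> real^'d \<Rightarrow> real^'d \<Rightarrow> real" where
  "barycentric T x = (THE w. (\<forall>P. P \<notin> vertices T \<longrightarrow> w P = 0) \<and> (\<Sum>P\<in>vertices T. w P) = 1 \<and>
     (\<Sum>P\<in>vertices T. w P *\<^sub>R P) = x)"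

text \<open>The scaling of the bubble does not affect the space that the bubbles span.\<close>

definition bubble :: "(real^'d::finite) set \<Rightarrow> real^'d \<Rightarrow> real" where
  "bubble T x = (if x \<in> T then \<Prod>P\<in>vertices T. barycentric T x P else 0)"

definition V_bubble :: "(real^'d::finite) set set \<Rightarrow> (real^'d \<Rightarrow> real^'d) set" where
  "V_bubble \<T> = {v. \<exists>c. v = (\<lambda>x. \<Sum>T\<in>\<T>. bubble T x *\<^sub>R c T)}"

definition V_mini :: "(real^'d::finite) set \<Rightarrow> (real^'d) set set \<Rightarrow> (real^'d \<Rightarrow> real^'d) set" where
  "V_mini \<Omega> \<T> = {(\<lambda>x. v x + b x) | v b. v \<in> V_linear \<Omega> \<T> \<and> b \<in> V_bubble \<T>}"

text \<open>The inner product of matrices, as elements of \<open>real^'d^'d\<close>, is the Frobenius product.\<close>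

definition a_form :: "(real^'d::finite) set \<Rightarrow> real \<Rightarrow> real \<Rightarrow>
    (real^'d \<Rightarrow> real^'d) \<Rightarrow> (real^'d \<Rightarrow> real^'d) \<Rightarrow> real" where
  "a_form \<Omega> lam \<mu> u v = 2 * \<mu> * ip \<Omega> (strain u) (strain v) + lam * ip \<Omega> (divg u) (divg v)"

definition norm_A :: "(real^'d::finite) set \<Rightarrow> real \<Rightarrow> real \<Rightarrow> (real^'d \<Rightarrow> real^'d) \<Rightarrow> real" where
  "norm_A \<Omega> lam \<mu> v = sqrt (a_form \<Omega> lam \<mu> v v)"

definition ap_form :: "(real^'d::finite) set \<Rightarrow> real \<Rightarrow> (real^'d \<Rightarrow> real) \<Rightarrow> (real^'d \<Rightarrow> real) \<Rightarrow> real" where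
  "ap_form \<Omega> K p q = ip \<Omega> (\<lambda>x. K *\<^sub>R grad p x) (grad q)"

definition ip_lumped :: "(real^'d::finite) set set \<Rightarrow> (real^'d \<Rightarrow> real) \<Rightarrow> (real^'d \<Rightarrow> real) \<Rightarrow> real" where
  "ip_lumped \<T> p q =
     (\<Sum>T\<in>\<T>. measure lebesgue T / real (CARD('d) + 1) * (\<Sum>P\<in>vertices T. p P * q P))"

definition ip_Z :: "(real^'d::finite) set \<Rightarrow> (real^'d) set set \<Rightarrow>
    (real^'d \<Rightarrow> real) \<Rightarrow> (real^'d \<Rightarrow> real) \<Rightarrow> real" where
  "ip_Z \<Omega> \<T> p q = ip_lumped \<T> p q - ip \<Omega> p q"

text \<open>This is the square of the seminorm; keeping it free of a square root means that its
  nonnegativity is not hidden in a convention for roots of negative numbers.\<close>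

definition norm_Z_sq :: "(real^'d::finite) set \<Rightarrow> (real^'d) set set \<Rightarrow> (real^'d \<Rightarrow> real) \<Rightarrow> real" where
  "norm_Z_sq \<Omega> \<T> q = ip_Z \<Omega> \<T> q q"

definition h_grad_norm :: "(real^'d::finite) set set \<Rightarrow> (real^'d \<Rightarrow> real) \<Rightarrow> real" where
  "h_grad_norm \<T> q =
     sqrt (\<Sum>T\<in>\<T>. (diameter T)\<^sup>2 * set_lebesgue_integral lebesgue T (\<lambda>x. (norm (grad q x))\<^sup>2))"

definition diff_quot :: "real \<Rightarrow> ('a \<Rightarrow> 'b::real_vector) \<Rightarrow> ('a \<Rightarrow> 'b) \<Rightarrow> 'a \<Rightarrow> 'b" where
  "diff_quot \<tau> f f' x = (1 / \<tau>) *\<^sub>R (f x - f' x)"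

definition momentum_equation :: "(real^'d::finite) set \<Rightarrow> (real^'d \<Rightarrow> real^'d) set \<Rightarrow>
    real \<Rightarrow> real \<Rightarrow> real \<Rightarrow> (real^'d \<Rightarrow> real^'d) \<Rightarrow> (real^'d \<Rightarrow> real^'d) \<Rightarrow> (real^'d \<Rightarrow> real) \<Rightarrow> bool" where
  "momentum_equation \<Omega> V lam \<mu> \<alpha> f u p \<longleftrightarrow>
     (\<forall>v\<in>V. a_form \<Omega> lam \<mu> u v - \<alpha> * ip \<Omega> p (divg v) = ip \<Omega> f v)"

text \<open>
  For data of the previous time step this equation, with the current load \<open>f\<close>, is a genuine
  compatibility condition: it says that the error of the initial guess satisfies
  \<open>a(e_u, v) = \<alpha> (e_p, div v)\<close>, as the errors of all later iterates do. Without it the first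
  iteration need not contract.
\<close>

text \<open>In the following, \<open>\<beta>i\<close> stands for \<open>1/\<beta>\<close>, which may be zero, and \<open>u'\<close>, \<open>p'\<close> are the discrete
  solution at the previous time.\<close>

definition stabilized_scheme :: "(real^'d::finite) set \<Rightarrow> (real^'d) set set \<Rightarrow>
    (real^'d \<Rightarrow> real^'d) set \<Rightarrow> real \<Rightarrow> real \<Rightarrow> real \<Rightarrow> real \<Rightarrow> real \<Rightarrow> real \<Rightarrow> real \<Rightarrow>
    (real^'d \<Rightarrow> real^'d) \<Rightarrow> (real^'d \<Rightarrow> real) \<Rightarrow>
    (real^'d \<Rightarrow> real^'d) \<Rightarrow> (real^'d \<Rightarrow> real) \<Rightarrow>
    (real^'d \<Rightarrow> real^'d) \<Rightarrow> (real^'d \<Rightarrow> real) \<Rightarrow> bool" where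
  "stabilized_scheme \<Omega> \<T> V lam \<mu> \<alpha> \<beta>i K \<tau> L f g u' p' u p \<longleftrightarrow>
     u \<in> V \<and> p \<in> Q_space \<Omega> \<T> \<and>
     momentum_equation \<Omega> V lam \<mu> \<alpha> f u p \<and>
     (\<forall>q\<in>Q_space \<Omega> \<T>.
        \<beta>i * ip \<Omega> (diff_quot \<tau> p p') q + \<alpha> * ip \<Omega> (divg (diff_quot \<tau> u u')) q + ap_form \<Omega> K p q
        + L * ip_lumped \<T> (diff_quot \<tau> p p') q - L * ip \<Omega> (diff_quot \<tau> p p') q
        = ip \<Omega> g q)"

text \<open>\<open>us i\<close> and \<open>ps i\<close> are the iterates.\<close>

definition two_parameter_iteration :: "(real^'d::finite) set \<Rightarrow> (real^'d) set set \<Rightarrow>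
    (real^'d \<Rightarrow> real^'d) set \<Rightarrow> real \<Rightarrow> real \<Rightarrow> real \<Rightarrow> real \<Rightarrow> real \<Rightarrow> real \<Rightarrow> real \<Rightarrow> real \<Rightarrow> real \<Rightarrow>
    (real^'d \<Rightarrow> real^'d) \<Rightarrow> (real^'d \<Rightarrow> real) \<Rightarrow>
    (real^'d \<Rightarrow> real^'d) \<Rightarrow> (real^'d \<Rightarrow> real) \<Rightarrow>
    (nat \<Rightarrow> real^'d \<Rightarrow> real^'d) \<Rightarrow> (nat \<Rightarrow> real^'d \<Rightarrow> real) \<Rightarrow> bool" where
  "two_parameter_iteration \<Omega> \<T> V lam \<mu> \<alpha> \<beta>i K \<tau> L \<gamma>\<^sub>1 \<gamma>\<^sub>2 f g u' p' us ps \<longleftrightarrow>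
     us 0 = u' \<and> ps 0 = p' \<and>
     (\<forall>i\<ge>1. ps i \<in> Q_space \<Omega> \<T> \<and>
        (\<forall>q\<in>Q_space \<Omega> \<T>.
           \<beta>i * ip \<Omega> (diff_quot \<tau> (ps i) p') q
           + \<gamma>\<^sub>1 * L * ip_lumped \<T> (diff_quot \<tau> (ps i) p') q
           - \<gamma>\<^sub>2 * L * ip \<Omega> (diff_quot \<tau> (ps i) p') q
           + ap_form \<Omega> K (ps i) q
           = (1 - \<gamma>\<^sub>2) * L * ip \<Omega> (diff_quot \<tau> (ps (i - 1)) p') q
           + (\<gamma>\<^sub>1 - 1) * L * ip_lumped \<T> (diff_quot \<tau> (ps (i - 1)) p') q
           - \<alpha> * ip \<Omega> (divg (diff_quot \<tau> (us (i - 1)) u')) q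
           + ip \<Omega> g q)) \<and>
     (\<forall>i\<ge>1. us i \<in> V \<and>
        (\<forall>v\<in>V. a_form \<Omega> lam \<mu> (us i) v = \<alpha> * ip \<Omega> (ps i) (divg v) + ip \<Omega> f v))"

definition weak_inf_sup :: "(real^'d::finite) set \<Rightarrow> (real^'d) set set \<Rightarrow>
    (real^'d \<Rightarrow> real^'d) set \<Rightarrow> real \<Rightarrow> real \<Rightarrow> real \<Rightarrow> real \<Rightarrow> bool" where
  "weak_inf_sup \<Omega> \<T> V lam \<mu> \<eta> \<epsilon> \<longleftrightarrow>
     (\<forall>q\<in>Q_space \<Omega> \<T>.
        (SUP w\<in>V - {\<lambda>x. 0}. ip \<Omega> q (divg w) / norm_A \<Omega> lam \<mu> w) \<ge>
        \<eta> / sqrt (lam + 2 * \<mu> / real CARD('d)) * L2_norm \<Omega> q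
        - \<epsilon> / sqrt (lam + 2 * \<mu> / real CARD('d)) * h_grad_norm \<T> q)"

definition spectral_equivalence :: "(real^'d::finite) set \<Rightarrow> (real^'d) set set \<Rightarrow> real \<Rightarrow> real \<Rightarrow> bool" where
  "spectral_equivalence \<Omega> \<T> C\<^sub>1 C\<^sub>2 \<longleftrightarrow>
     C\<^sub>1 > 0 \<and> C\<^sub>2 > 0 \<and>
     (\<forall>q\<in>Q_space \<Omega> \<T>. C\<^sub>1 * norm_Z_sq \<Omega> \<T> q \<le> (h_grad_norm \<T> q)\<^sup>2 \<and>
                       (h_grad_norm \<T> q)\<^sup>2 \<le> C\<^sub>2 * norm_Z_sq \<Omega> \<T> q)"

definition is_theta_star :: "real \<Rightarrow> real \<Rightarrow> real \<Rightarrow> real \<Rightarrow> real \<Rightarrow> real \<Rightarrow> bool" where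
  "is_theta_star \<gamma>\<^sub>1 \<omega> \<eta> \<epsilon> C\<^sub>2 \<theta> \<longleftrightarrow>
     \<theta> \<ge> \<epsilon>\<^sup>2 * C\<^sub>2 * \<gamma>\<^sub>1 / (4 * \<omega> * (\<gamma>\<^sub>1 - \<bar>1 - \<gamma>\<^sub>1\<bar>)) \<and>
     2 * (\<gamma>\<^sub>1 - \<bar>1 - \<gamma>\<^sub>1\<bar>) / \<gamma>\<^sub>1 * \<theta>\<^sup>2
     + ((\<gamma>\<^sub>1 - \<bar>1 - \<gamma>\<^sub>1\<bar>) / \<gamma>\<^sub>1 - \<eta>\<^sup>2 * \<bar>1 - \<gamma>\<^sub>1\<bar> / (2 * \<omega> * \<gamma>\<^sub>1) - \<epsilon>\<^sup>2 * C\<^sub>2 / (2 * \<omega>)) * \<theta>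
     - \<epsilon>\<^sup>2 * C\<^sub>2 / (4 * \<omega>) = 0"

end

theory Submission
  imports Defs
begin

text \<open>
  Testing the equation for the pressure error \<open>e\<^sup>i\<close> with \<open>e\<^sup>i\<close> itself turns the coupling term into
  \<open>a(e\<^sub>u\<^sup>i, e\<^sub>u\<^sup>i\<^sup>-\<^sup>1)\<close>. Polarization produces half the energies of both displacement errors minus half the
  energy of their difference; the latter is at most \<open>\<alpha>\<^sup>2 / (\<lambda> + 2 \<mu> / d) \<parallel>e\<^sup>i - e\<^sup>i\<^sup>-\<^sup>1\<parallel>\<^sup>2\<close>, which \<open>\<omega> \<ge> 1\<close>
  lets the stabilization absorb. The energy of \<open>e\<^sub>u\<^sup>i\<close> that is left over controls \<open>\<parallel>e\<^sup>i\<parallel>\<^sup>2\<close> up to a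
  multiple of \<open>\<parallel>e\<^sup>i\<parallel>\<^sub>Z\<^sup>2\<close> by the weak inf-sup condition and Young's inequality with parameter \<open>2 \<theta>\<close>; the
  quadratic equation for \<open>\<theta>\<^sup>*\<close> balances the two resulting contraction factors.
\<close>

section \<open>Square integrable functions and the pressure space\<close>

text \<open>Derivatives here are pointwise, \<open>frechet_derivative\<close> is an arbitrary choice
  where a function is not differentiable, and the integral of a function that is not integrable is
  0. Hence no form is bilinear for free. Linearity is recovered because every discrete function is
  differentiable off the null union of the element boundaries, with derivatives that extend
  continuously to each closed element and so are square integrable. The bubbles fit in because
  barycentric coordinates are affine on the whole space.

  The constant \<open>lam + 2 * \<mu> / d\<close> stems from the inequality between the trace and
  the Frobenius norm of a matrix. The bound on the energy of the difference of two successive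
  displacement errors needs the momentum relation for both of them. For the first iteration this
  involves the initial data, so convergence is driven by the contraction from the second iteration
  on. Positive definiteness of \<open>a_form\<close> is never established; test fields of zero
  energy are treated separately in the inf-sup quotient.\<close>

lemma L2_space_alt:
  "f \<in> L2_space \<Omega> \<longleftrightarrow> (\<lambda>x. indicator \<Omega> x *\<^sub>R f x) \<in> borel_measurable lebesgue \<and>
     integrable lebesgue (\<lambda>x. indicator \<Omega> x *\<^sub>R (norm (f x))\<^sup>2)"
  by (simp add: L2_space_def set_borel_measurable_def set_integrable_def)

lemma borel_measurable_norm_sq:
  fixes h :: "'a \<Rightarrow> 'b::euclidean_space"
  shows "h \<in> borel_measurable M \<Longrightarrow> (\<lambda>x. (norm (h x))\<^sup>2) \<in> borel_measurable M"
  by measurable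

lemma L2_integrable_inner:
  fixes f g :: "real^'d::finite \<Rightarrow> 'b::euclidean_space"
  assumes "f \<in> L2_space \<Omega>" "g \<in> L2_space \<Omega>"
  shows "set_integrable lebesgue \<Omega> (\<lambda>x. f x \<bullet> g x)"
  unfolding set_integrable_def
proof (rule Bochner_Integration.integrable_bound)
  show "integrable lebesgue
     (\<lambda>x. indicator \<Omega> x *\<^sub>R (norm (f x))\<^sup>2 + indicator \<Omega> x *\<^sub>R (norm (g x))\<^sup>2)"
    using assms by (auto simp: L2_space_alt)
  \<comment> \<open>Measurability is known only for \<open>f\<close> and \<open>g\<close> cut off to
    \<open>\<Omega>\<close>, so the indicator, being idempotent, is given to both factors.\<close>
  have eq: "(\<lambda>x. indicator \<Omega> x *\<^sub>R (f x \<bullet> g x)) = (\<lambda>x. (indicator \<Omega> x *\<^sub>R f x) \<bullet> (indicator \<Omega> x *\<^sub>R g x))"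
    by (auto simp: indicator_def)
  show "(\<lambda>x. indicator \<Omega> x *\<^sub>R (f x \<bullet> g x)) \<in> borel_measurable lebesgue"
    unfolding eq using assms by (intro borel_measurable_inner) (auto simp: L2_space_alt)
  have "\<bar>f x \<bullet> g x\<bar> \<le> (norm (f x))\<^sup>2 + (norm (g x))\<^sup>2" for x
  proof -
    have "\<bar>f x \<bullet> g x\<bar> \<le> norm (f x) * norm (g x)" by (rule Cauchy_Schwarz_ineq2)
    moreover have "2 * norm (f x) * norm (g x) \<le> (norm (f x))\<^sup>2 + (norm (g x))\<^sup>2"
      by (rule sum_squares_bound)
    moreover have "0 \<le> norm (f x) * norm (g x)" by simp
    ultimately show ?thesis by linarith
  qed
  then show "AE x in lebesgue. norm (indicator \<Omega> x *\<^sub>R (f x \<bullet> g x))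
      \<le> norm (indicator \<Omega> x *\<^sub>R (norm (f x))\<^sup>2 + indicator \<Omega> x *\<^sub>R (norm (g x))\<^sup>2)"
    by (auto simp: indicator_def)
qed

lemma L2_lincomb:
  fixes f g :: "real^'d::finite \<Rightarrow> 'b::euclidean_space"
  assumes "f \<in> L2_space \<Omega>" "g \<in> L2_space \<Omega>"
  shows "(\<lambda>x. a *\<^sub>R f x + b *\<^sub>R g x) \<in> L2_space \<Omega>"
proof -
  have "(\<lambda>x. indicator \<Omega> x *\<^sub>R (a *\<^sub>R f x + b *\<^sub>R g x))
      = (\<lambda>x. a *\<^sub>R (indicator \<Omega> x *\<^sub>R f x) + b *\<^sub>R (indicator \<Omega> x *\<^sub>R g x))"
    by (auto simp: indicator_def)
  also have "\<dots> \<in> borel_measurable lebesgue"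
    using assms by (intro borel_measurable_add borel_measurable_scaleR[OF borel_measurable_const])
      (auto simp: L2_space_alt)
  finally have m: "(\<lambda>x. indicator \<Omega> x *\<^sub>R (a *\<^sub>R f x + b *\<^sub>R g x)) \<in> borel_measurable lebesgue" .
  have eq: "(\<lambda>x. indicator \<Omega> x *\<^sub>R (norm (a *\<^sub>R f x + b *\<^sub>R g x))\<^sup>2)
      = (\<lambda>x. a\<^sup>2 * (indicator \<Omega> x *\<^sub>R (norm (f x))\<^sup>2) + 2 * a * b * (indicator \<Omega> x *\<^sub>R (f x \<bullet> g x))
             + b\<^sup>2 * (indicator \<Omega> x *\<^sub>R (norm (g x))\<^sup>2))"
    unfolding power2_norm_eq_inner
    by (rule ext) (simp add: inner_add_left inner_add_right inner_commute algebra_simps power2_eq_square)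
  have "integrable lebesgue (\<lambda>x. indicator \<Omega> x *\<^sub>R (norm (a *\<^sub>R f x + b *\<^sub>R g x))\<^sup>2)"
    unfolding eq
    using assms L2_integrable_inner[OF assms]
    by (intro Bochner_Integration.integrable_add integrable_mult_right)
      (auto simp: L2_space_alt set_integrable_def)
  with m show ?thesis by (simp only: L2_space_alt)
qed

lemma L2_diff:
  fixes f g :: "real^'d::finite \<Rightarrow> 'b::euclidean_space"
  assumes "f \<in> L2_space \<Omega>" "g \<in> L2_space \<Omega>"
  shows "(\<lambda>x. f x - g x) \<in> L2_space \<Omega>"
  using L2_lincomb[OF assms, of 1 "-1"] by simp

lemma ip_commute: "ip \<Omega> f g = ip \<Omega> g f"
  by (simp add: ip_def inner_commute)

lemma ip_nonneg: "0 \<le> ip \<Omega> f f"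
  by (auto simp: ip_def set_lebesgue_integral_def intro!: integral_nonneg)

text \<open>Membership in \<open>L2_space\<close> supplies the integrability without which the
  integral is not additive, as it is 0 by default on other functions.\<close>

lemma ip_lincomb_left:
  fixes f g h :: "real^'d::finite \<Rightarrow> 'b::euclidean_space"
  assumes "f \<in> L2_space \<Omega>" "g \<in> L2_space \<Omega>" "h \<in> L2_space \<Omega>"
  shows "ip \<Omega> (\<lambda>x. a *\<^sub>R f x + b *\<^sub>R g x) h = a * ip \<Omega> f h + b * ip \<Omega> g h"
  using set_integral_add[of lebesgue \<Omega> "\<lambda>x. a * (f x \<bullet> h x)" "\<lambda>x. b * (g x \<bullet> h x)"]
    L2_integrable_inner[OF assms(1,3)] L2_integrable_inner[OF assms(2,3)]
  by (simp add: ip_def inner_add_left)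

lemma ip_lincomb_right:
  fixes f g h :: "real^'d::finite \<Rightarrow> 'b::euclidean_space"
  assumes "f \<in> L2_space \<Omega>" "g \<in> L2_space \<Omega>" "h \<in> L2_space \<Omega>"
  shows "ip \<Omega> h (\<lambda>x. a *\<^sub>R f x + b *\<^sub>R g x) = a * ip \<Omega> h f + b * ip \<Omega> h g"
  using ip_lincomb_left[OF assms] by (simp add: ip_commute)

lemma ip_lincomb_self:
  fixes f g :: "real^'d::finite \<Rightarrow> 'b::euclidean_space"
  assumes "f \<in> L2_space \<Omega>" "g \<in> L2_space \<Omega>"
  shows "ip \<Omega> (\<lambda>x. a *\<^sub>R f x + b *\<^sub>R g x) (\<lambda>x. a *\<^sub>R f x + b *\<^sub>R g x)
    = a\<^sup>2 * ip \<Omega> f f + 2 * a * b * ip \<Omega> f g + b\<^sup>2 * ip \<Omega> g g"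
  using assms
  by (simp add: ip_lincomb_left ip_lincomb_right L2_lincomb ip_commute[of \<Omega> g f]
      algebra_simps power2_eq_square)

lemma AE_lebesgue_off_negligible:
  assumes "negligible N" "\<And>x. x \<notin> N \<Longrightarrow> P x"
  shows "AE x in lebesgue. P x"
  using assms by (intro AE_I'[of N]) (auto simp: negligible_iff_null_sets)

text \<open>Serves to replace the derivative of a linear combination by the combination of
  derivatives, an identity that may fail on the boundaries of elements. The four memberships provide
  measurability of both integrands.\<close>

lemma ip_cong_negligible:
  assumes "negligible N" "\<And>x. x \<in> \<Omega> - N \<Longrightarrow> f x = f' x" "\<And>x. x \<in> \<Omega> - N \<Longrightarrow> g x = g' x"
    "f \<in> L2_space \<Omega>" "g \<in> L2_space \<Omega>" "f' \<in> L2_space \<Omega>" "g' \<in> L2_space \<Omega>"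
  shows "ip \<Omega> f g = ip \<Omega> f' g'"
  unfolding ip_def set_lebesgue_integral_def
proof (rule integral_cong_AE)
  show "AE x in lebesgue. indicator \<Omega> x *\<^sub>R (f x \<bullet> g x) = indicator \<Omega> x *\<^sub>R (f' x \<bullet> g' x)"
    using assms(1) by (rule AE_lebesgue_off_negligible) (auto simp: indicator_def assms(2,3))
qed (use L2_integrable_inner[OF assms(4,5)] L2_integrable_inner[OF assms(6,7)]
     in \<open>auto simp: set_integrable_def\<close>)

text \<open>\<open>F\<close> will be a classical derivative with uncontrolled values on
  \<open>N\<close>; completeness of Lebesgue measure passes measurability from \<open>g\<close> to
  it.\<close>

lemma L2_of_bounded_measurable_off_negligible:
  fixes F :: "real^'d::finite \<Rightarrow> 'b::euclidean_space"
  assumes "open \<Omega>" "bounded \<Omega>" "negligible N"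
    and g: "g \<in> borel_measurable lebesgue" and B: "\<And>x. norm (g x) \<le> B"
    and eq: "\<And>x. x \<in> \<Omega> - N \<Longrightarrow> F x = g x"
  shows "F \<in> L2_space \<Omega>"
proof -
  have S[measurable]: "\<Omega> \<in> sets lebesgue" and fin: "emeasure lebesgue \<Omega> < \<infinity>"
    using lmeasurable_open[OF assms(2,1)] by (auto simp: fmeasurable_def)
  have AE: "AE x in lebesgue. indicator \<Omega> x *\<^sub>R g x = indicator \<Omega> x *\<^sub>R F x"
    using assms(3) by (rule AE_lebesgue_off_negligible) (auto simp: indicator_def eq)
  have m: "(\<lambda>x. indicator \<Omega> x *\<^sub>R F x) \<in> borel_measurable lebesgue"
    by (rule borel_measurable_AE[OF _ AE]) (use g in measurable)
  have "integrable lebesgue (\<lambda>x. indicator \<Omega> x *\<^sub>R (norm (F x))\<^sup>2)"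
  proof (rule Bochner_Integration.integrable_bound)
    show "integrable lebesgue (\<lambda>x. indicator \<Omega> x *\<^sub>R B\<^sup>2)"
      by (rule integrable_indicator[OF S fin])
    have "(\<lambda>x. indicator \<Omega> x *\<^sub>R (norm (F x))\<^sup>2) = (\<lambda>x. (norm (indicator \<Omega> x *\<^sub>R F x))\<^sup>2)"
      by (auto simp: indicator_def)
    then show "(\<lambda>x. indicator \<Omega> x *\<^sub>R (norm (F x))\<^sup>2) \<in> borel_measurable lebesgue"
      using borel_measurable_norm_sq[OF m] by (simp only:)
    show "AE x in lebesgue. norm (indicator \<Omega> x *\<^sub>R (norm (F x))\<^sup>2) \<le> norm (indicator \<Omega> x *\<^sub>R B\<^sup>2)"
      using assms(3)
    proof (rule AE_lebesgue_off_negligible)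
      fix x assume "x \<notin> N"
      have "(norm (g x))\<^sup>2 \<le> B\<^sup>2" by (intro power_mono B) auto
      then show "norm (indicator \<Omega> x *\<^sub>R (norm (F x))\<^sup>2) \<le> norm (indicator \<Omega> x *\<^sub>R B\<^sup>2)"
        using eq[of x] \<open>x \<notin> N\<close> by (auto simp: indicator_def)
    qed
  qed
  with m show ?thesis by (simp add: L2_space_alt)
qed

section \<open>Gradients, test functions and the linear structure of the pressure space\<close>

lemma has_derivative_grad:
  assumes "(q has_derivative (\<lambda>h. G \<bullet> h)) (at x)"
  shows "grad q x = G"
proof -
  have "frechet_derivative q (at x) = (\<lambda>h. G \<bullet> h)"
    using frechet_derivative_at[OF assms] by simp
  then show ?thesis by (simp add: grad_def inner_axis vec_eq_iff)
qed

lemma has_derivative_jacobian: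
  fixes v :: "real^'d::finite \<Rightarrow> real^'n::finite"
  assumes "(v has_derivative (\<lambda>h. J *v h)) (at x)"
  shows "jacobian v (at x) = J"
proof -
  have "frechet_derivative v (at x) = (\<lambda>h. J *v h)"
    using frechet_derivative_at[OF assms] by simp
  then show ?thesis by (simp add: jacobian_def matrix_of_matrix_vector_mul)
qed

lemma smooth_has_gradient:
  assumes "smooth \<phi>"
  obtains "continuous_on UNIV (grad \<phi>)" "\<And>x. (\<phi> has_derivative (\<lambda>h. grad \<phi> x \<bullet> h)) (at x)"
proof -
  obtain D where D: "D [] = \<phi>"
    "\<And>is x. (D is has_derivative (\<lambda>h. \<Sum>i\<in>UNIV. h $ i * D (i # is) x)) (at x)"
    using assms unfolding smooth_def by blast
  define G where "G x = (\<chi> i. D [i] x)" for x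
  have d: "(\<phi> has_derivative (\<lambda>h. G x \<bullet> h)) (at x)" for x
    using D(2)[of "[]" x] by (simp add: D(1) G_def inner_vec_def mult.commute)
  then have G: "grad \<phi> = G" by (auto intro: has_derivative_grad)
  have "continuous_on UNIV (D [i])" for i
    using D(2)[of "[i]"] by (intro continuous_at_imp_continuous_on) (auto intro: has_derivative_continuous)
  then have "continuous_on UNIV G" unfolding G_def by (intro continuous_on_vec_lambda)
  with d G that show ?thesis by simp
qed

text \<open>The premises express differentiability at \<open>x\<close>, phrased with
  \<open>grad\<close> itself so that no separate derivative has to be named.\<close>

lemma grad_lincomb:
  assumes "(p has_derivative (\<lambda>h. grad p x \<bullet> h)) (at x)" "(q has_derivative (\<lambda>h. grad q x \<bullet> h)) (at x)"
  shows "grad (\<lambda>x. a *\<^sub>R p x + b *\<^sub>R q x) x = a *\<^sub>R grad p x + b *\<^sub>R grad q x"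
  by (rule has_derivative_grad)
    (auto intro!: derivative_eq_intros assms simp: inner_add_left)

lemma test_functions_lincomb:
  assumes "\<phi> \<in> test_functions \<Omega>" "\<psi> \<in> test_functions \<Omega>"
  shows "(\<lambda>x. a *\<^sub>R \<phi> x + b *\<^sub>R \<psi> x) \<in> test_functions \<Omega>"
proof -
  obtain D E where
    D: "D [] = \<phi>" "\<And>is x. (D is has_derivative (\<lambda>h. \<Sum>i\<in>UNIV. h $ i * D (i # is) x)) (at x)" and
    E: "E [] = \<psi>" "\<And>is x. (E is has_derivative (\<lambda>h. \<Sum>i\<in>UNIV. h $ i * E (i # is) x)) (at x)"
    using assms unfolding test_functions_def smooth_def mem_Collect_eq by blast
  have "smooth (\<lambda>x. a *\<^sub>R \<phi> x + b *\<^sub>R \<psi> x)"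
    unfolding smooth_def
    by (rule exI[of _ "\<lambda>is x. a * D is x + b * E is x"])
      (auto simp: D(1) E(1) sum.distrib sum_distrib_left algebra_simps
        intro!: derivative_eq_intros D(2) E(2))
  moreover
  let ?S = "closure {x. \<phi> x \<noteq> 0} \<union> closure {x. \<psi> x \<noteq> 0}"
  have sub: "closure {x. a *\<^sub>R \<phi> x + b *\<^sub>R \<psi> x \<noteq> 0} \<subseteq> ?S"
    unfolding closure_Un[symmetric] by (intro closure_mono) auto
  have "compact (?S \<inter> closure {x. a *\<^sub>R \<phi> x + b *\<^sub>R \<psi> x \<noteq> 0})"
    using assms by (intro compact_Int_closed) (auto simp: test_functions_def)
  with sub have "compact (closure {x. a *\<^sub>R \<phi> x + b *\<^sub>R \<psi> x \<noteq> 0})"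
    by (simp add: Int_absorb1)
  ultimately show ?thesis using sub assms by (auto simp: test_functions_def)
qed

lemma continuous_compact_support_L2:
  fixes f :: "real^'d::finite \<Rightarrow> 'b::euclidean_space"
  assumes "open \<Omega>" "bounded \<Omega>" "continuous_on UNIV f" "compact K" "\<And>x. x \<notin> K \<Longrightarrow> f x = 0"
  shows "f \<in> L2_space \<Omega>"
proof -
  have "compact (f ` K)" using assms(3,4) by (meson compact_continuous_image continuous_on_subset subset_UNIV)
  then obtain B where B: "\<And>x. x \<in> K \<Longrightarrow> norm (f x) \<le> B"
    by (metis bounded_iff compact_imp_bounded imageI)
  have "norm (f x) \<le> max B 0" for x using B[of x] assms(5)[of x] by (cases "x \<in> K") auto
  moreover have "f \<in> borel_measurable lebesgue"
    using assms(3) by (simp add: borel_measurable_continuous_onI measurable_completion)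
  ultimately show ?thesis
    using assms(1,2) by (intro L2_of_bounded_measurable_off_negligible[of \<Omega> "{}" f "max B 0"]) auto
qed

lemma test_functions_L2:
  assumes "open \<Omega>" "bounded \<Omega>" "\<phi> \<in> test_functions \<Omega>"
  shows "\<phi> \<in> L2_space \<Omega>" "grad \<phi> \<in> L2_space \<Omega>"
proof -
  let ?K = "closure {x. \<phi> x \<noteq> 0}"
  have sm: "smooth \<phi>" and K: "compact ?K" using assms(3) by (auto simp: test_functions_def)
  obtain cg: "continuous_on UNIV (grad \<phi>)" and d: "\<And>x. (\<phi> has_derivative (\<lambda>h. grad \<phi> x \<bullet> h)) (at x)"
    using smooth_has_gradient[OF sm] by blast
  have "continuous_on UNIV \<phi>"
    using d by (intro continuous_at_imp_continuous_on) (auto intro: has_derivative_continuous)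
  moreover have "\<phi> x = 0" if "x \<notin> ?K" for x
    using that closure_subset[of "{x. \<phi> x \<noteq> 0}"] by auto
  ultimately show "\<phi> \<in> L2_space \<Omega>"
    using assms(1,2) K by (intro continuous_compact_support_L2[of \<Omega> \<phi> ?K])
  have "grad \<phi> x = 0" if "x \<notin> ?K" for x
  proof (rule has_derivative_grad)
    have "((\<lambda>x. 0::real) has_derivative (\<lambda>h. 0 \<bullet> h)) (at x)" by simp
    then show "(\<phi> has_derivative (\<lambda>h. 0 \<bullet> h)) (at x)"
      by (rule has_derivative_transform_within_open[of _ _ _ _ "- ?K"])
        (use that closure_subset[of "{x. \<phi> x \<noteq> 0}"] in auto)
  qed
  then show "grad \<phi> \<in> L2_space \<Omega>"
    using assms(1,2) cg K by (intro continuous_compact_support_L2[of \<Omega> "grad \<phi>" ?K])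
qed

lemma L2_component:
  fixes f :: "real^'d::finite \<Rightarrow> real^'n::finite"
  assumes "f \<in> L2_space \<Omega>"
  shows "(\<lambda>x. f x $ i) \<in> L2_space \<Omega>"
proof -
  have eq: "(\<lambda>x. indicator \<Omega> x *\<^sub>R f x $ i) = (\<lambda>x. (indicator \<Omega> x *\<^sub>R f x) \<bullet> axis i 1)"
    by (auto simp: inner_axis)
  have m: "(\<lambda>x. indicator \<Omega> x *\<^sub>R f x $ i) \<in> borel_measurable lebesgue"
    unfolding eq using assms by (intro borel_measurable_inner) (auto simp: L2_space_alt)
  moreover have "integrable lebesgue (\<lambda>x. indicator \<Omega> x *\<^sub>R (norm (f x $ i))\<^sup>2)"
  proof (rule Bochner_Integration.integrable_bound)
    show "integrable lebesgue (\<lambda>x. indicator \<Omega> x *\<^sub>R (norm (f x))\<^sup>2)"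
      using assms by (simp add: L2_space_alt)
    have "(\<lambda>x. indicator \<Omega> x *\<^sub>R (norm (f x $ i))\<^sup>2) = (\<lambda>x. (norm (indicator \<Omega> x *\<^sub>R f x $ i))\<^sup>2)"
      by (auto simp: indicator_def)
    then show "(\<lambda>x. indicator \<Omega> x *\<^sub>R (norm (f x $ i))\<^sup>2) \<in> borel_measurable lebesgue"
      using borel_measurable_norm_sq[OF m] by (simp only:)
    have "(f x $ i)\<^sup>2 \<le> (norm (f x))\<^sup>2" for x
      using component_le_norm_cart[of "f x" i] by (metis abs_ge_zero power2_abs power_mono)
    then show "AE x in lebesgue. norm (indicator \<Omega> x *\<^sub>R (norm (f x $ i))\<^sup>2)
        \<le> norm (indicator \<Omega> x *\<^sub>R (norm (f x))\<^sup>2)"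
      by (auto simp: indicator_def)
  qed
  ultimately show ?thesis by (simp add: L2_space_alt)
qed

lemma L2_norm_sq: "(L2_norm \<Omega> f)\<^sup>2 = ip \<Omega> f f"
  by (simp add: L2_norm_def ip_nonneg)

lemma L2_norm_lincomb_tendsto_0:
  fixes F G :: "nat \<Rightarrow> real^'d::finite \<Rightarrow> 'b::euclidean_space"
  assumes "\<And>k. F k \<in> L2_space \<Omega>" "\<And>k. G k \<in> L2_space \<Omega>"
    and "(\<lambda>k. L2_norm \<Omega> (F k)) \<longlonglongrightarrow> 0" "(\<lambda>k. L2_norm \<Omega> (G k)) \<longlonglongrightarrow> 0"
  shows "(\<lambda>k. L2_norm \<Omega> (\<lambda>x. a *\<^sub>R F k x + b *\<^sub>R G k x)) \<longlonglongrightarrow> 0"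
proof -
  \<comment> \<open>Parallelogram law: the squared norms for \<open>b\<close> and for
    \<open>-b\<close> add up to the right-hand side, and the one for \<open>-b\<close> is
    nonnegative.\<close>
  have le: "ip \<Omega> (\<lambda>x. a *\<^sub>R F k x + b *\<^sub>R G k x) (\<lambda>x. a *\<^sub>R F k x + b *\<^sub>R G k x)
      \<le> 2 * a\<^sup>2 * (L2_norm \<Omega> (F k))\<^sup>2 + 2 * b\<^sup>2 * (L2_norm \<Omega> (G k))\<^sup>2" for k
    using ip_lincomb_self[OF assms(1,2), of a k b k] ip_lincomb_self[OF assms(1,2), of a k "-b" k]
      ip_nonneg[of \<Omega> "\<lambda>x. a *\<^sub>R F k x + (-b) *\<^sub>R G k x"]
    unfolding L2_norm_sq by simp
  have lim: "(\<lambda>k. 2 * a\<^sup>2 * (L2_norm \<Omega> (F k))\<^sup>2 + 2 * b\<^sup>2 * (L2_norm \<Omega> (G k))\<^sup>2) \<longlonglongrightarrow>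
      2 * a\<^sup>2 * 0\<^sup>2 + 2 * b\<^sup>2 * 0\<^sup>2"
    by (intro tendsto_intros assms)
  have "(\<lambda>k. ip \<Omega> (\<lambda>x. a *\<^sub>R F k x + b *\<^sub>R G k x) (\<lambda>x. a *\<^sub>R F k x + b *\<^sub>R G k x)) \<longlonglongrightarrow> 0"
    by (rule tendsto_sandwich[OF _ _ tendsto_const, of 0]) (use lim le in \<open>auto simp: ip_nonneg\<close>)
  from tendsto_real_sqrt[OF this] show ?thesis by (simp add: L2_norm_def)
qed

text \<open>Weak gradients and approximating sequences combine linearly. This is what admits the
  pressure errors, differences of discrete functions, as test functions.\<close>

lemma H10_lincomb:
  fixes \<Omega> :: "(real^'d::finite) set"
  assumes om: "open \<Omega>" "bounded \<Omega>" and u: "u \<in> H10 \<Omega>" and w: "w \<in> H10 \<Omega>"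
  shows "(\<lambda>x. a *\<^sub>R u x + b *\<^sub>R w x) \<in> H10 \<Omega>"
proof -
  obtain G \<phi> where uL: "u \<in> L2_space \<Omega>" and G: "G \<in> L2_space \<Omega>" "has_weak_gradient \<Omega> u G"
    and \<phi>: "\<And>k. \<phi> k \<in> test_functions \<Omega>" "(\<lambda>k. L2_norm \<Omega> (\<lambda>x. \<phi> k x - u x)) \<longlonglongrightarrow> 0"
      "(\<lambda>k. L2_norm \<Omega> (\<lambda>x. grad (\<phi> k) x - G x)) \<longlonglongrightarrow> 0"
    using u unfolding H10_def by blast
  obtain H \<psi> where wL: "w \<in> L2_space \<Omega>" and H: "H \<in> L2_space \<Omega>" "has_weak_gradient \<Omega> w H"
    and \<psi>: "\<And>k. \<psi> k \<in> test_functions \<Omega>" "(\<lambda>k. L2_norm \<Omega> (\<lambda>x. \<psi> k x - w x)) \<longlonglongrightarrow> 0"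
      "(\<lambda>k. L2_norm \<Omega> (\<lambda>x. grad (\<psi> k) x - H x)) \<longlonglongrightarrow> 0"
    using w unfolding H10_def by blast
  note tf = test_functions_L2[OF om]
  let ?G = "\<lambda>x. a *\<^sub>R G x + b *\<^sub>R H x" and ?\<phi> = "\<lambda>k x. a *\<^sub>R \<phi> k x + b *\<^sub>R \<psi> k x"
  have "has_weak_gradient \<Omega> (\<lambda>x. a *\<^sub>R u x + b *\<^sub>R w x) ?G"
    unfolding has_weak_gradient_def
  proof (intro ballI allI)
    fix \<xi> :: "real^'d \<Rightarrow> real" and i assume \<xi>: "\<xi> \<in> test_functions \<Omega>"
    have "ip \<Omega> (\<lambda>x. a *\<^sub>R u x + b *\<^sub>R w x) (\<lambda>x. grad \<xi> x $ i)
        = a * ip \<Omega> u (\<lambda>x. grad \<xi> x $ i) + b * ip \<Omega> w (\<lambda>x. grad \<xi> x $ i)"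
      by (intro ip_lincomb_left uL wL L2_component tf \<xi>)
    also have "\<dots> = - (a * ip \<Omega> (\<lambda>x. G x $ i) \<xi> + b * ip \<Omega> (\<lambda>x. H x $ i) \<xi>)"
      using G(2) H(2) \<xi> by (simp add: has_weak_gradient_def)
    also have "\<dots> = - ip \<Omega> (\<lambda>x. a *\<^sub>R G x $ i + b *\<^sub>R H x $ i) \<xi>"
      using ip_lincomb_left[OF L2_component[OF G(1)] L2_component[OF H(1)] tf(1)[OF \<xi>]] by metis
    finally show "ip \<Omega> (\<lambda>x. a *\<^sub>R u x + b *\<^sub>R w x) (\<lambda>x. grad \<xi> x $ i) = - ip \<Omega> (\<lambda>x. ?G x $ i) \<xi>"
      by simp
  qed
  moreover have "(\<lambda>k. L2_norm \<Omega> (\<lambda>x. ?\<phi> k x - (a *\<^sub>R u x + b *\<^sub>R w x))) \<longlonglongrightarrow> 0"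
    using L2_norm_lincomb_tendsto_0[OF _ _ \<phi>(2) \<psi>(2), of a b]
    by (simp add: L2_diff tf uL wL \<phi>(1) \<psi>(1) algebra_simps)
  moreover have "(\<lambda>k. L2_norm \<Omega> (\<lambda>x. grad (?\<phi> k) x - ?G x)) \<longlonglongrightarrow> 0"
  proof -
    have "(\<lambda>x. grad (?\<phi> k) x - ?G x)
        = (\<lambda>x. a *\<^sub>R (grad (\<phi> k) x - G x) + b *\<^sub>R (grad (\<psi> k) x - H x))" for k
    proof
      have "smooth (\<phi> k)" "smooth (\<psi> k)" using \<phi>(1) \<psi>(1) by (auto simp: test_functions_def)
      then show "grad (?\<phi> k) x - ?G x = a *\<^sub>R (grad (\<phi> k) x - G x) + b *\<^sub>R (grad (\<psi> k) x - H x)" for x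
        by (subst grad_lincomb) (auto elim!: smooth_has_gradient simp: algebra_simps)
    qed
    then show ?thesis
      using L2_norm_lincomb_tendsto_0[OF _ _ \<phi>(3) \<psi>(3), of a b]
      by (simp add: L2_diff tf G(1) H(1) \<phi>(1) \<psi>(1))
  qed
  ultimately show ?thesis
    unfolding H10_def using L2_lincomb[OF uL wL] L2_lincomb[OF G(1) H(1)]
      test_functions_lincomb[OF \<phi>(1) \<psi>(1)]
    by (auto intro!: bexI[of _ ?G] exI[of _ ?\<phi>])
qed

lemma P1_on_lincomb:
  assumes "P1_on T p" "P1_on T q"
  shows "P1_on T (\<lambda>x. a *\<^sub>R p x + b *\<^sub>R q x)"
proof -
  obtain c d c' d' where "\<forall>x\<in>T. p x = c + d \<bullet> x" "\<forall>x\<in>T. q x = c' + d' \<bullet> x"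
    using assms by (auto simp: P1_on_def)
  then show ?thesis unfolding P1_on_def
    by (intro exI[of _ "a * c + b * c'"] exI[of _ "a *\<^sub>R d + b *\<^sub>R d'"])
      (auto simp: algebra_simps inner_add_left)
qed

lemma Q_space_lincomb:
  assumes "open \<Omega>" "bounded \<Omega>" "p \<in> Q_space \<Omega> \<T>" "q \<in> Q_space \<Omega> \<T>"
  shows "(\<lambda>x. a *\<^sub>R p x + b *\<^sub>R q x) \<in> Q_space \<Omega> \<T>"
  using assms unfolding Q_space_def
  by (auto intro!: H10_lincomb P1_on_lincomb simp del: real_scaleR_def)

section \<open>Piecewise smooth fields on a simplicial partition\<close>

lemma affine_vector_has_derivative:
  fixes J :: "real^'d::finite^'n::finite"
  shows "((\<lambda>x. c + J *v x) has_derivative (\<lambda>h. J *v h)) (at x)"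
  using bounded_linear_imp_has_derivative[OF matrix_vector_mul_bounded_linear[of J], of "at x"]
  by (auto intro!: derivative_eq_intros)

text \<open>The Jacobian is the outer product of \<open>c\<close> and the gradient; it is needed for
  bubbles with a vector coefficient.\<close>

lemma scalar_times_vector_has_derivative:
  fixes \<phi> :: "real^'d::finite \<Rightarrow> real" and c :: "real^'n::finite"
  assumes "(\<phi> has_derivative (\<lambda>h. G \<bullet> h)) (at x)"
  shows "((\<lambda>x. \<phi> x *\<^sub>R c) has_derivative (\<lambda>h. (\<chi> i j. c $ i * G $ j) *v h)) (at x)"
proof -
  have "(\<lambda>h. (\<chi> i j. c $ i * G $ j) *v h) = (\<lambda>h. (G \<bullet> h) *\<^sub>R c)"
    by (rule ext) (simp add: vec_eq_iff matrix_vector_mult_def inner_vec_def sum_distrib_left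
        sum_distrib_right mult_ac)
  then show ?thesis by (auto intro!: derivative_eq_intros assms)
qed

text \<open>A full-dimensional simplex has \<open>d + 1\<close> affinely independent vertices, whose
  affine hull is the whole space. So the description in \<open>barycentric\<close> has exactly one
  solution at every point, also outside \<open>T\<close>, and uniqueness forces the coordinates to
  be affine.\<close>

lemma barycentric_affine:
  fixes T :: "(real^'d::finite) set"
  assumes "int CARD('d) simplex T"
  obtains c a where "\<And>x. barycentric T x P = c + a \<bullet> x"
proof -
  obtain C where C: "finite C" "\<not> affine_dependent C" "int (card C) = int CARD('d) + 1" "T = convex hull C"
    using assms by (auto simp: simplex)
  have vert: "vertices T = C"
    using C by (auto simp: vertices_def extreme_point_of_convex_hull_affine_independent)
  have "aff_dim C = int DIM(real^'d)"
    using C by (simp add: affine_independent_iff_card)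
  then have full: "affine hull C = UNIV" by (simp only: aff_dim_eq_full)
  define bc where "bc x w \<longleftrightarrow> (\<forall>P. P \<notin> C \<longrightarrow> w P = 0) \<and> (\<Sum>P\<in>C. w P) = 1 \<and> (\<Sum>P\<in>C. w P *\<^sub>R P) = x"
    for x :: "real^'d" and w :: "real^'d \<Rightarrow> real"
  have uniq: "w = w'" if "bc x w" "bc x w'" for x w w'
  proof (rule ccontr)
    assume "w \<noteq> w'"
    then obtain Q where Q: "w Q \<noteq> w' Q" by auto
    then have "Q \<in> C" using that unfolding bc_def by metis
    moreover have "(\<Sum>P\<in>C. w P - w' P) = 0" "(\<Sum>P\<in>C. (w P - w' P) *\<^sub>R P) = 0"
      using that by (auto simp: bc_def sum_subtractf scaleR_diff_left)
    ultimately have "affine_dependent C"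
      unfolding affine_dependent_explicit_finite[OF C(1)]
      using Q by (intro exI[of _ "\<lambda>P. w P - w' P"]) auto
    with C(2) show False by simp
  qed
  have ex: "\<exists>w. bc x w" for x
  proof -
    have "x \<in> affine hull C" using full by simp
    then obtain w where w: "sum w C = 1" "(\<Sum>v\<in>C. w v *\<^sub>R v) = x"
      by (auto simp: affine_hull_finite[OF C(1)])
    then show ?thesis unfolding bc_def
      by (intro exI[of _ "\<lambda>P. if P \<in> C then w P else 0"]) (auto cong: sum.cong)
  qed
  have "\<exists>!w. bc x w" for x using ex uniq by blast
  then have bary: "bc x (barycentric T x)" for x
    unfolding barycentric_def vert bc_def[symmetric] by (rule theI')
  define f where "f x = barycentric T x P - barycentric T 0 P" for x
  have "linear f"
  proof (rule linearI)
    fix x y :: "real^'d" and r :: real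
    \<comment> \<open>Subtracting the coordinates of the origin keeps the total weight at 1 + 1 - 1
      and leaves the represented point at \<open>x + y\<close>.\<close>
    let ?w = "\<lambda>P. barycentric T x P + barycentric T y P - barycentric T 0 P"
    have "bc (x + y) ?w"
      using bary[of x] bary[of y] bary[of 0]
      by (simp add: bc_def sum.distrib sum_subtractf algebra_simps)
    with uniq bary have "barycentric T (x + y) = ?w" by blast
    then show "f (x + y) = f x + f y" by (simp add: f_def)
    let ?v = "\<lambda>P. r * barycentric T x P + (1 - r) * barycentric T 0 P"
    have "bc (r *\<^sub>R x) ?v"
      using bary[of x] bary[of 0]
      by (auto simp: bc_def sum.distrib scaleR_add_left scaleR_scaleR[symmetric]
          sum_distrib_left[symmetric] scaleR_right.sum[symmetric] simp del: scaleR_scaleR)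
    with uniq bary have "barycentric T (r *\<^sub>R x) = ?v" by blast
    then show "f (r *\<^sub>R x) = r *\<^sub>R f x" by (simp add: f_def algebra_simps)
  qed
  \<comment> \<open>The adjoint applied to 1 is the vector that represents the linear functional
    \<open>f\<close>.\<close>
  then have "f x = adjoint f 1 \<bullet> x" for x
    using adjoint_works[of f x 1] by (simp add: inner_commute)
  then have "barycentric T x P = barycentric T 0 P + adjoint f 1 \<bullet> x" for x
    by (metis f_def diff_add_cancel add.commute)
  then show ?thesis by (rule that)
qed

text \<open>The derivative is asserted only inside the elements, where jumps across faces do no
  harm. Continuity of \<open>J\<close> on the closed, compact element makes the derivative bounded
  and thus square integrable.\<close>

definition piecewise_C1 :: "(real^'d::finite) set set \<Rightarrow> (real^'d \<Rightarrow> real^'d) \<Rightarrow> bool" where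
  "piecewise_C1 \<T> v \<longleftrightarrow> (\<forall>T\<in>\<T>. \<exists>J :: real^'d \<Rightarrow> real^'d^'d. continuous_on T J \<and>
     (\<forall>x\<in>interior T. (v has_derivative (\<lambda>h. J x *v h)) (at x)))"

lemma piecewise_C1_lincomb:
  assumes "piecewise_C1 \<T> v" "piecewise_C1 \<T> w"
  shows "piecewise_C1 \<T> (\<lambda>x. a *\<^sub>R v x + b *\<^sub>R w x)"
  unfolding piecewise_C1_def
proof
  fix T assume T: "T \<in> \<T>"
  obtain J where J: "continuous_on T J" "\<And>x. x \<in> interior T \<Longrightarrow> (v has_derivative (\<lambda>h. J x *v h)) (at x)"
    using assms(1) T unfolding piecewise_C1_def by blast
  obtain K where K: "continuous_on T K" "\<And>x. x \<in> interior T \<Longrightarrow> (w has_derivative (\<lambda>h. K x *v h)) (at x)"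
    using assms(2) T unfolding piecewise_C1_def by blast
  have "continuous_on T (\<lambda>x. a *\<^sub>R J x + b *\<^sub>R K x)"
    by (intro continuous_intros J K)
  moreover have "((\<lambda>x. a *\<^sub>R v x + b *\<^sub>R w x) has_derivative (\<lambda>h. (a *\<^sub>R J x + b *\<^sub>R K x) *v h)) (at x)"
    if "x \<in> interior T" for x
    unfolding matrix_vector_mult_add_rdistrib scaleR_matrix_vector_assoc[symmetric]
    by (intro derivative_intros J(2) K(2) that)
  ultimately show "\<exists>J. continuous_on T J \<and> (\<forall>x\<in>interior T.
      ((\<lambda>x. a *\<^sub>R v x + b *\<^sub>R w x) has_derivative (\<lambda>h. J x *v h)) (at x))"
    by blast
qed

lemma piecewise_C1_sum:
  fixes v :: "'i \<Rightarrow> real^'a::finite \<Rightarrow> real^'a"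
  assumes "finite I" "\<And>i. i \<in> I \<Longrightarrow> piecewise_C1 \<T> (v i)"
  shows "piecewise_C1 \<T> (\<lambda>x. \<Sum>i\<in>I. v i x)"
  using assms
proof (induction I rule: finite_induct)
  case empty
  have "((\<lambda>x. 0 :: real^'a) has_derivative (\<lambda>h. (0 :: real^'a^'a) *v h)) (at x)" for x by simp
  then have "\<exists>J :: real^'a \<Rightarrow> real^'a^'a. continuous_on T J \<and>
      (\<forall>x\<in>interior T. ((\<lambda>x. 0 :: real^'a) has_derivative (\<lambda>h. J x *v h)) (at x))" for T
    by (intro exI[of _ "\<lambda>x. 0"] conjI ballI) auto
  then show ?case unfolding piecewise_C1_def sum.empty by blast
next
  case (insert i I)
  then have "piecewise_C1 \<T> (\<lambda>x. 1 *\<^sub>R v i x + 1 *\<^sub>R (\<Sum>i\<in>I. v i x))"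
    by (intro piecewise_C1_lincomb) auto
  with insert show ?case by simp
qed

lemma piecewise_C1_P1:
  assumes "\<forall>T\<in>\<T>. \<forall>i. P1_on T (\<lambda>x. v x $ i)"
  shows "piecewise_C1 \<T> v"
  unfolding piecewise_C1_def
proof
  fix T assume "T \<in> \<T>"
  then obtain c a where ca: "\<And>i x. x \<in> T \<Longrightarrow> v x $ i = c i + a i \<bullet> x"
    using assms unfolding P1_on_def by metis
  define J where "J = (\<chi> i. a i)"
  have v: "(\<chi> i. c i) + J *v x = v x" if "x \<in> interior T" for x
    using ca[of x] that interior_subset[of T]
    by (auto simp: vec_eq_iff J_def matrix_vector_mult_def inner_vec_def)
  have "(v has_derivative (\<lambda>h. J *v h)) (at x)" if "x \<in> interior T" for x
    by (rule has_derivative_transform_within_open[OF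
          affine_vector_has_derivative[of "\<chi> i. c i" J] open_interior that]) (rule v)
  then show "\<exists>J. continuous_on T J \<and> (\<forall>x\<in>interior T. (v has_derivative (\<lambda>h. J x *v h)) (at x))"
    by (intro exI[of _ "\<lambda>x. J"]) auto
qed

section \<open>The mesh: null skeleton, disjoint interiors and the discrete spaces\<close>

locale mesh =
  fixes \<Omega> :: "(real^'d::finite) set" and \<T> :: "(real^'d) set set"
  assumes domain: "bounded_domain \<Omega>" and partition: "simplicial_partition \<Omega> \<T>"
begin

definition skeleton :: "(real^'d) set" where
  "skeleton = (\<Union>T\<in>\<T>. frontier T)"

lemma open_domain: "open \<Omega>" and bounded_dom: "bounded \<Omega>"
  using domain by (auto simp: bounded_domain_def)

lemma finite_mesh: "finite \<T>"
  using partition by (simp add: simplicial_partition_def triangulation_def)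

lemma mesh_simplex: "T \<in> \<T> \<Longrightarrow> int CARD('d) simplex T"
  using partition by (simp add: simplicial_partition_def)

lemma mesh_compact: "T \<in> \<T> \<Longrightarrow> compact T"
  using mesh_simplex simplex_imp_polytope polytope_imp_compact by blast

lemma mesh_convex: "T \<in> \<T> \<Longrightarrow> convex T"
  using mesh_simplex simplex_imp_polytope polytope_imp_convex by blast

lemma negligible_skeleton: "negligible skeleton"
  unfolding skeleton_def using finite_mesh mesh_convex
  by (intro negligible_Union) (auto intro: negligible_convex_frontier)

lemma off_skeleton:
  assumes "x \<in> \<Omega> - skeleton"
  obtains T where "T \<in> \<T>" "x \<in> interior T"
proof -
  have "x \<in> \<Union>\<T>"
    using assms partition closure_subset[of \<Omega>] by (auto simp: simplicial_partition_def)
  then obtain T where T: "T \<in> \<T>" "x \<in> T" by auto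
  then have "x \<in> interior T"
    using assms closure_subset[of T] by (auto simp: skeleton_def frontier_def)
  with T that show ?thesis by blast
qed

text \<open>A face that meets the relative interior of \<open>T\<close> is all of \<open>T\<close>.
  So \<open>T\<close> is a face of \<open>T'\<close>, and a proper face would have smaller
  dimension.\<close>

lemma interior_disjoint:
  assumes "T \<in> \<T>" "T' \<in> \<T>" "x \<in> interior T" "x \<in> T'"
  shows "T = T'"
proof -
  have f1: "T \<inter> T' face_of T" and f2: "T' \<inter> T face_of T'"
    using partition assms by (auto simp: simplicial_partition_def triangulation_def)
  have "T \<inter> T' = T"
  proof (rule ccontr)
    assume "T \<inter> T' \<noteq> T"
    then have "(T \<inter> T') \<inter> rel_interior T = {}"
      by (rule face_of_disjoint_rel_interior[OF f1])
    then show False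
      using assms interior_subset[of T] interior_subset_rel_interior[of T] by auto
  qed
  then have "T face_of T'" using f2 by (simp add: Int_commute)
  moreover have "aff_dim T = aff_dim T'"
    using assms mesh_simplex aff_dim_simplex by metis
  ultimately show ?thesis
    using face_of_aff_dim_lt[OF mesh_convex[OF assms(2)]] by force
qed

text \<open>Cutting each \<open>g\<close> off to the open element and summing gives a bounded Borel
  function. At a point off the skeleton exactly one summand can be nonzero, so the sum is
  \<open>F\<close> there.\<close>

lemma L2_piecewise_continuous:
  fixes F :: "real^'d \<Rightarrow> 'b::euclidean_space"
  assumes "\<And>T. T \<in> \<T> \<Longrightarrow> \<exists>g. continuous_on T g \<and> (\<forall>x\<in>interior T. F x = g x)"
  shows "F \<in> L2_space \<Omega>"
proof -
  obtain g where g: "\<And>T. T \<in> \<T> \<Longrightarrow> continuous_on T (g T)"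
    "\<And>T x. T \<in> \<T> \<Longrightarrow> x \<in> interior T \<Longrightarrow> F x = g T x"
    using assms by metis
  have "\<exists>B\<ge>0. \<forall>x\<in>T. norm (g T x) \<le> B" if "T \<in> \<T>" for T
  proof -
    have "bounded (g T ` T)"
      using that g(1) mesh_compact by (intro compact_imp_bounded compact_continuous_image)
    then obtain B where "\<forall>x\<in>T. norm (g T x) \<le> B" by (auto simp: bounded_iff)
    then show ?thesis by (intro exI[of _ "max B 0"]) auto
  qed
  then obtain B where B: "\<And>T. T \<in> \<T> \<Longrightarrow> 0 \<le> B T" "\<And>T x. T \<in> \<T> \<Longrightarrow> x \<in> T \<Longrightarrow> norm (g T x) \<le> B T"
    by metis
  define G where "G x = (\<Sum>T\<in>\<T>. indicator (interior T) x *\<^sub>R g T x)" for x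
  have "G \<in> borel_measurable borel"
    unfolding G_def
    by (intro borel_measurable_sum borel_measurable_continuous_on_indicator)
      (auto intro: continuous_on_subset[OF g(1) interior_subset])
  then have "G \<in> borel_measurable lebesgue" by (simp add: measurable_completion)
  moreover have "norm (G x) \<le> (\<Sum>T\<in>\<T>. B T)" for x
    unfolding G_def
  proof (intro sum_norm_le)
    fix T assume "T \<in> \<T>"
    then show "norm (indicator (interior T) x *\<^sub>R g T x) \<le> B T"
      using B[of T] interior_subset[of T] by (auto simp: indicator_def)
  qed
  moreover have "F x = G x" if x: "x \<in> \<Omega> - skeleton" for x
  proof -
    obtain T where T: "T \<in> \<T>" "x \<in> interior T" using off_skeleton[OF x] .
    have "G x = (\<Sum>S\<in>\<T>. if S = T then g T x else 0)"
      unfolding G_def using interior_disjoint[OF T(1) _ T(2)] interior_subset T(2)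
      by (intro sum.cong) (auto simp: indicator_def)
    with T finite_mesh g(2) show ?thesis by simp
  qed
  ultimately show ?thesis
    using L2_of_bounded_measurable_off_negligible[OF open_domain bounded_dom negligible_skeleton] by blast
qed

lemma P1_gradient:
  assumes "T \<in> \<T>" "P1_on T q"
  obtains G where "\<And>x. x \<in> interior T \<Longrightarrow> (q has_derivative (\<lambda>h. G \<bullet> h)) (at x)"
proof -
  obtain c a where ca: "\<And>x. x \<in> T \<Longrightarrow> q x = c + a \<bullet> x"
    using assms by (auto simp: P1_on_def)
  have "(q has_derivative (\<lambda>h. a \<bullet> h)) (at x)" if "x \<in> interior T" for x
  proof (rule has_derivative_transform_within_open[OF _ open_interior that])
    show "((\<lambda>x. c + a \<bullet> x) has_derivative (\<lambda>h. a \<bullet> h)) (at x)"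
      by (auto intro!: derivative_eq_intros)
  qed (use ca interior_subset[of T] in auto)
  then show ?thesis by (rule that)
qed

lemma Q_space_grad_L2:
  assumes "q \<in> Q_space \<Omega> \<T>"
  shows "grad q \<in> L2_space \<Omega>"
proof (rule L2_piecewise_continuous)
  fix T assume T: "T \<in> \<T>"
  then have "P1_on T q" using assms by (simp add: Q_space_def)
  then obtain G where "\<And>x. x \<in> interior T \<Longrightarrow> (q has_derivative (\<lambda>h. G \<bullet> h)) (at x)"
    using P1_gradient[OF T] by blast
  then have "\<forall>x\<in>interior T. grad q x = G" using has_derivative_grad by blast
  then show "\<exists>g. continuous_on T g \<and> (\<forall>x\<in>interior T. grad q x = g x)"
    by (intro exI[of _ "\<lambda>x. G"]) auto
qed

lemma Q_space_has_derivative: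
  assumes "q \<in> Q_space \<Omega> \<T>" "x \<in> \<Omega> - skeleton"
  shows "(q has_derivative (\<lambda>h. grad q x \<bullet> h)) (at x)"
proof -
  obtain T where T: "T \<in> \<T>" "x \<in> interior T" using off_skeleton[OF assms(2)] .
  then have "P1_on T q" using assms by (simp add: Q_space_def)
  then obtain G where "(q has_derivative (\<lambda>h. G \<bullet> h)) (at x)"
    using P1_gradient[OF T(1)] T(2) by blast
  then show ?thesis using has_derivative_grad by metis
qed

text \<open>Inside a foreign element the bubble vanishes; inside its own it coincides with a product
  of affine functions, which is smooth on the whole space.\<close>

lemma bubble_piecewise_C1:
  assumes "S \<in> \<T>"
  shows "piecewise_C1 \<T> (\<lambda>x. bubble S x *\<^sub>R c)"
  unfolding piecewise_C1_def
proof
  fix T assume T: "T \<in> \<T>"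
  let ?v = "\<lambda>x. bubble S x *\<^sub>R c"
  show "\<exists>J. continuous_on T J \<and> (\<forall>x\<in>interior T. (?v has_derivative (\<lambda>h. J x *v h)) (at x))"
  proof (cases "T = S")
    case False
    have "(?v has_derivative (\<lambda>h. 0 *v h)) (at x)" if "x \<in> interior T" for x
    proof (rule has_derivative_transform_within_open[OF _ open_interior that])
      show "((\<lambda>x. 0) has_derivative (\<lambda>h. 0 *v h)) (at x)" by simp
    qed (use False interior_disjoint[OF T assms] in \<open>auto simp: bubble_def\<close>)
    then show ?thesis by (intro exI[of _ "\<lambda>x. 0"]) auto
  next
    case True
    obtain k a where ka: "\<And>P x. barycentric S x P = k P + a P \<bullet> x"
    proof -
      have "\<exists>k a. \<forall>x. barycentric S x P = k + a \<bullet> x" for P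
        using barycentric_affine[OF mesh_simplex[OF assms]] by blast
      then show ?thesis using that by metis
    qed
    \<comment> \<open>The product rule: each vertex contributes the gradient of its own factor times
      the remaining factors.\<close>
    define G where
      "G x = (\<Sum>P\<in>vertices S. (\<Prod>Q\<in>vertices S - {P}. k Q + a Q \<bullet> x) *\<^sub>R a P)" for x
    have d: "((\<lambda>x. \<Prod>P\<in>vertices S. k P + a P \<bullet> x) has_derivative (\<lambda>h. G x \<bullet> h)) (at x)" for x
    proof -
      have "((\<lambda>x. k P + a P \<bullet> x) has_derivative (\<lambda>h. a P \<bullet> h)) (at x)" for P
        by (auto intro!: derivative_eq_intros)
      from has_derivative_prod[of "vertices S", OF this]
      show ?thesis by (simp add: G_def inner_sum_left mult.commute)
    qed
    have "(?v has_derivative (\<lambda>h. (\<chi> i j. c $ i * G x $ j) *v h)) (at x)" if "x \<in> interior T" for x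
      by (rule has_derivative_transform_within_open[OF
            scalar_times_vector_has_derivative[OF d] open_interior that])
        (use True interior_subset[of T] in \<open>auto simp: bubble_def ka\<close>)
    moreover have "continuous_on T (\<lambda>x. (\<chi> i j. c $ i * G x $ j))"
      unfolding G_def by (intro continuous_on_vec_lambda continuous_intros)
    ultimately show ?thesis by blast
  qed
qed

lemma piecewise_C1_spaces:
  assumes "V = V_linear \<Omega> \<T> \<or> V = V_mini \<Omega> \<T>" "v \<in> V"
  shows "piecewise_C1 \<T> v"
proof -
  have lin: "piecewise_C1 \<T> w" if "w \<in> V_linear \<Omega> \<T>" for w
    using that by (intro piecewise_C1_P1) (simp add: V_linear_def)
  have bub: "piecewise_C1 \<T> w" if "w \<in> V_bubble \<T>" for w
    using that by (auto simp: V_bubble_def intro!: piecewise_C1_sum finite_mesh bubble_piecewise_C1)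
  show ?thesis
  proof (cases "v \<in> V_linear \<Omega> \<T>")
    case False
    then obtain w b where "w \<in> V_linear \<Omega> \<T>" "b \<in> V_bubble \<T>" "v = (\<lambda>x. w x + b x)"
      using assms by (auto simp: V_mini_def)
    then show ?thesis
      using piecewise_C1_lincomb[OF lin[of w] bub[of b], of 1 1] by simp
  qed (rule lin)
qed

lemma V_linear_lincomb:
  assumes "v \<in> V_linear \<Omega> \<T>" "w \<in> V_linear \<Omega> \<T>"
  shows "(\<lambda>x. a *\<^sub>R v x + b *\<^sub>R w x) \<in> V_linear \<Omega> \<T>"
proof -
  have "P1_on T (\<lambda>x. (a *\<^sub>R v x + b *\<^sub>R w x) $ i)" if "T \<in> \<T>" for T i
    using P1_on_lincomb[of T "\<lambda>x. v x $ i" "\<lambda>x. w x $ i" a b] assms that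
    by (simp add: V_linear_def)
  then show ?thesis using assms unfolding V_linear_def
    by (auto intro!: continuous_intros)
qed

lemma V_bubble_lincomb:
  assumes "v \<in> V_bubble \<T>" "w \<in> V_bubble \<T>"
  shows "(\<lambda>x. a *\<^sub>R v x + b *\<^sub>R w x) \<in> V_bubble \<T>"
proof -
  obtain c d where "v = (\<lambda>x. \<Sum>T\<in>\<T>. bubble T x *\<^sub>R c T)" "w = (\<lambda>x. \<Sum>T\<in>\<T>. bubble T x *\<^sub>R d T)"
    using assms by (auto simp: V_bubble_def)
  then show ?thesis unfolding V_bubble_def
    by (auto intro!: exI[of _ "\<lambda>T. a *\<^sub>R c T + b *\<^sub>R d T"]
        simp: fun_eq_iff scaleR_sum_right sum.distrib scaleR_add_right mult.commute)
qed

lemma V_lincomb: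
  assumes "V = V_linear \<Omega> \<T> \<or> V = V_mini \<Omega> \<T>" "v \<in> V" "w \<in> V"
  shows "(\<lambda>x. a *\<^sub>R v x + b *\<^sub>R w x) \<in> V"
  using assms(1)
proof
  assume V: "V = V_mini \<Omega> \<T>"
  obtain v1 v2 w1 w2 where vw: "v1 \<in> V_linear \<Omega> \<T>" "v2 \<in> V_bubble \<T>" "v = (\<lambda>x. v1 x + v2 x)"
    "w1 \<in> V_linear \<Omega> \<T>" "w2 \<in> V_bubble \<T>" "w = (\<lambda>x. w1 x + w2 x)"
    using assms by (auto simp: V V_mini_def)
  have "(\<lambda>x. (a *\<^sub>R v1 x + b *\<^sub>R w1 x) + (a *\<^sub>R v2 x + b *\<^sub>R w2 x)) \<in> V_mini \<Omega> \<T>"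
    unfolding V_mini_def using V_linear_lincomb[OF vw(1,4)] V_bubble_lincomb[OF vw(2,5)]
    by (intro CollectI exI conjI) (rule refl)
  then show ?thesis by (simp add: vw V algebra_simps)
qed (use assms V_linear_lincomb in simp)

lemma has_derivative_off_skeleton:
  assumes "piecewise_C1 \<T> v" "x \<in> \<Omega> - skeleton"
  shows "(v has_derivative (\<lambda>h. jacobian v (at x) *v h)) (at x)"
proof -
  obtain T where T: "T \<in> \<T>" "x \<in> interior T" using off_skeleton[OF assms(2)] .
  then obtain J where "(v has_derivative (\<lambda>h. J *v h)) (at x)"
    using assms(1) unfolding piecewise_C1_def by blast
  then show ?thesis using has_derivative_jacobian by metis
qed

lemma jacobian_lincomb:
  assumes "piecewise_C1 \<T> v" "piecewise_C1 \<T> w" "x \<in> \<Omega> - skeleton"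
  shows "jacobian (\<lambda>x. a *\<^sub>R v x + b *\<^sub>R w x) (at x)
    = a *\<^sub>R jacobian v (at x) + b *\<^sub>R jacobian w (at x)"
  by (rule has_derivative_jacobian,
      unfold matrix_vector_mult_add_rdistrib scaleR_matrix_vector_assoc[symmetric])
    (intro derivative_intros has_derivative_off_skeleton assms)

lemma piecewise_C1_L2:
  assumes "piecewise_C1 \<T> v"
  shows "strain v \<in> L2_space \<Omega>" "divg v \<in> L2_space \<Omega>"
proof -
  have J: "\<exists>J. continuous_on T J \<and> (\<forall>x\<in>interior T. jacobian v (at x) = J x)" if "T \<in> \<T>" for T
    using assms that has_derivative_jacobian unfolding piecewise_C1_def by meson
  show "strain v \<in> L2_space \<Omega>"
  proof (rule L2_piecewise_continuous)
    fix T assume "T \<in> \<T>"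
    then obtain J where J: "continuous_on T J" "\<forall>x\<in>interior T. jacobian v (at x) = J x"
      using J by blast
    have "continuous_on T (\<lambda>x. (1/2) *\<^sub>R (J x + transpose (J x)))"
      unfolding transpose_def by (intro continuous_intros continuous_on_vec_lambda J)
    with J(2) show "\<exists>g. continuous_on T g \<and> (\<forall>x\<in>interior T. strain v x = g x)"
      by (intro exI[of _ "\<lambda>x. (1/2) *\<^sub>R (J x + transpose (J x))"]) (auto simp: strain_def)
  qed
  show "divg v \<in> L2_space \<Omega>"
  proof (rule L2_piecewise_continuous)
    fix T assume "T \<in> \<T>"
    then obtain J where J: "continuous_on T J" "\<forall>x\<in>interior T. jacobian v (at x) = J x"
      using J by blast
    have "continuous_on T (\<lambda>x. trace (J x))"
      unfolding trace_def by (intro continuous_intros J)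
    with J(2) show "\<exists>g. continuous_on T g \<and> (\<forall>x\<in>interior T. divg v x = g x)"
      by (intro exI[of _ "\<lambda>x. trace (J x)"]) (auto simp: divg_def)
  qed
qed

lemma strain_divg_lincomb:
  assumes "piecewise_C1 \<T> v" "piecewise_C1 \<T> w" "x \<in> \<Omega> - skeleton"
  shows "strain (\<lambda>x. a *\<^sub>R v x + b *\<^sub>R w x) x = a *\<^sub>R strain v x + b *\<^sub>R strain w x"
    and "divg (\<lambda>x. a *\<^sub>R v x + b *\<^sub>R w x) x = a *\<^sub>R divg v x + b *\<^sub>R divg w x"
  using jacobian_lincomb[OF assms, of a b]
  by (auto simp: strain_def divg_def vec_eq_iff transpose_def trace_def sum.distrib sum_distrib_left
      algebra_simps)

end

section \<open>Coercivity, the inf-sup bound and the contraction factor\<close>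

text \<open>Cauchy-Schwarz for the Frobenius product with the identity matrix, whose square norm is
  \<open>d\<close>. This is the origin of \<open>2 * \<mu> / d\<close> in the stabilization
  constant.\<close>

lemma trace_sq_le: "(trace S)\<^sup>2 \<le> real CARD('d) * (S \<bullet> S)" for S :: "real^'d::finite^'d"
proof -
  have "mat 1 \<bullet> S = trace S"
    by (simp add: inner_vec_def mat_def trace_def if_distrib[of "\<lambda>x. x * _"] cong: if_cong)
  moreover have "(mat 1 :: real^'d^'d) \<bullet> mat 1 = real CARD('d)"
    by (simp add: inner_vec_def mat_def if_distrib[of "\<lambda>x. x * _"] cong: if_cong)
  ultimately show ?thesis
    using Cauchy_Schwarz_ineq[of "mat 1" S] by simp
qed

text \<open>Transposition preserves the trace. Both sides use the same \<open>jacobian\<close>, so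
  this holds at every point, differentiable or not.\<close>

lemma divg_eq_trace_strain: "divg v x = trace (strain v x)"
  by (simp add: divg_def strain_def trace_def transpose_def sum_divide_distrib[symmetric] flip: sum_distrib_left)

lemma a_form_commute: "a_form \<Omega> lam \<mu> v w = a_form \<Omega> lam \<mu> w v"
  by (simp add: a_form_def ip_commute)

lemma a_form_nonneg: "lam \<ge> 0 \<Longrightarrow> \<mu> \<ge> 0 \<Longrightarrow> 0 \<le> a_form \<Omega> lam \<mu> v v"
  by (simp add: a_form_def ip_nonneg)

lemma ip_lumped_commute: "ip_lumped \<T> p q = ip_lumped \<T> q p"
  by (simp add: ip_lumped_def mult.commute)

lemma ip_lumped_lincomb_left:
  "ip_lumped \<T> (\<lambda>x. a *\<^sub>R p x + b *\<^sub>R q x) r = a * ip_lumped \<T> p r + b * ip_lumped \<T> q r"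
  by (simp add: ip_lumped_def sum.distrib sum_distrib_left sum_divide_distrib algebra_simps)

lemma diff_quot_eq: "diff_quot \<tau> f f' = (\<lambda>x. (1 / \<tau>) *\<^sub>R f x + (- (1 / \<tau>)) *\<^sub>R f' x)"
  by (rule ext) (simp add: diff_quot_def algebra_simps)

section \<open>The bilinear forms on the discrete spaces, and their bounds\<close>

context mesh
begin

lemma a_form_lincomb_left:
  assumes v: "piecewise_C1 \<T> v" and w: "piecewise_C1 \<T> w" and z: "piecewise_C1 \<T> z"
  shows "a_form \<Omega> lam \<mu> (\<lambda>x. a *\<^sub>R v x + b *\<^sub>R w x) z
    = a * a_form \<Omega> lam \<mu> v z + b * a_form \<Omega> lam \<mu> w z"
proof -
  note L2 = piecewise_C1_L2[OF v] piecewise_C1_L2[OF w] piecewise_C1_L2[OF z]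
    piecewise_C1_L2[OF piecewise_C1_lincomb[OF v w, of a b]]
  have "ip \<Omega> (strain (\<lambda>x. a *\<^sub>R v x + b *\<^sub>R w x)) (strain z)
      = ip \<Omega> (\<lambda>x. a *\<^sub>R strain v x + b *\<^sub>R strain w x) (strain z)"
    by (intro ip_cong_negligible[OF negligible_skeleton] strain_divg_lincomb[OF v w] L2 L2_lincomb refl)
  moreover have "ip \<Omega> (divg (\<lambda>x. a *\<^sub>R v x + b *\<^sub>R w x)) (divg z)
      = ip \<Omega> (\<lambda>x. a *\<^sub>R divg v x + b *\<^sub>R divg w x) (divg z)"
    by (intro ip_cong_negligible[OF negligible_skeleton] strain_divg_lincomb[OF v w] L2 L2_lincomb refl)
  ultimately show ?thesis
    by (simp add: a_form_def ip_lincomb_left L2 algebra_simps del: real_scaleR_def)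
qed

lemma ip_divg_lincomb:
  assumes v: "piecewise_C1 \<T> v" and w: "piecewise_C1 \<T> w" and q: "q \<in> L2_space \<Omega>"
  shows "ip \<Omega> (divg (\<lambda>x. a *\<^sub>R v x + b *\<^sub>R w x)) q = a * ip \<Omega> (divg v) q + b * ip \<Omega> (divg w) q"
proof -
  note L2 = piecewise_C1_L2(2)[OF v] piecewise_C1_L2(2)[OF w]
    piecewise_C1_L2(2)[OF piecewise_C1_lincomb[OF v w, of a b]]
  have "ip \<Omega> (divg (\<lambda>x. a *\<^sub>R v x + b *\<^sub>R w x)) q
      = ip \<Omega> (\<lambda>x. a *\<^sub>R divg v x + b *\<^sub>R divg w x) q"
    by (intro ip_cong_negligible[OF negligible_skeleton] strain_divg_lincomb[OF v w] L2 L2_lincomb q refl)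
  then show ?thesis by (simp add: ip_lincomb_left L2 q del: real_scaleR_def)
qed

lemma ap_form_lincomb_left:
  assumes p: "p \<in> Q_space \<Omega> \<T>" and q: "q \<in> Q_space \<Omega> \<T>" and r: "r \<in> Q_space \<Omega> \<T>"
  shows "ap_form \<Omega> K (\<lambda>x. a *\<^sub>R p x + b *\<^sub>R q x) r = a * ap_form \<Omega> K p r + b * ap_form \<Omega> K q r"
proof -
  note L2 = Q_space_grad_L2[OF p] Q_space_grad_L2[OF q] Q_space_grad_L2[OF r]
    Q_space_grad_L2[OF Q_space_lincomb[OF open_domain bounded_dom p q, of a b]]
  have scale: "ap_form \<Omega> K s r = K * ip \<Omega> (grad s) (grad r)" for s
    by (simp add: ap_form_def ip_def)
  have "ip \<Omega> (grad (\<lambda>x. a *\<^sub>R p x + b *\<^sub>R q x)) (grad r)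
      = ip \<Omega> (\<lambda>x. a *\<^sub>R grad p x + b *\<^sub>R grad q x) (grad r)"
    by (intro ip_cong_negligible[OF negligible_skeleton] grad_lincomb Q_space_has_derivative p q
        L2 L2_lincomb refl)
  then show ?thesis by (simp add: scale ip_lincomb_left L2 algebra_simps del: real_scaleR_def)
qed

lemma ap_form_nonneg: "K \<ge> 0 \<Longrightarrow> 0 \<le> ap_form \<Omega> K p p"
  using ip_nonneg[of \<Omega> "grad p"] by (simp add: ap_form_def ip_def)

lemma divg_le_a_form:
  assumes "piecewise_C1 \<T> v" "\<mu> \<ge> 0"
  shows "(lam + 2 * \<mu> / real CARD('d)) * ip \<Omega> (divg v) (divg v) \<le> a_form \<Omega> lam \<mu> v v"
proof -
  note L2 = piecewise_C1_L2[OF assms(1)]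
  have "ip \<Omega> (divg v) (divg v)
      \<le> set_lebesgue_integral lebesgue \<Omega> (\<lambda>x. real CARD('d) * (strain v x \<bullet> strain v x))"
    unfolding ip_def
  proof (rule set_integral_mono)
    show "divg v x \<bullet> divg v x \<le> real CARD('d) * (strain v x \<bullet> strain v x)" for x
      using trace_sq_le[of "strain v x"] by (simp add: divg_eq_trace_strain power2_eq_square)
    show "set_integrable lebesgue \<Omega> (\<lambda>x. divg v x \<bullet> divg v x)"
      by (rule L2_integrable_inner[OF L2(2) L2(2)])
    show "set_integrable lebesgue \<Omega> (\<lambda>x. real CARD('d) * (strain v x \<bullet> strain v x))"
      using L2_integrable_inner[OF L2(1) L2(1)] by simp
  qed
  then have "ip \<Omega> (divg v) (divg v) \<le> real CARD('d) * ip \<Omega> (strain v) (strain v)"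
    by (simp add: ip_def)
  then have "2 * \<mu> / real CARD('d) * ip \<Omega> (divg v) (divg v)
      \<le> 2 * \<mu> / real CARD('d) * (real CARD('d) * ip \<Omega> (strain v) (strain v))"
    using assms(2) by (intro mult_left_mono) auto
  then show ?thesis by (simp add: a_form_def algebra_simps)
qed

text \<open>With \<open>\<kappa> = lam + 2 * \<mu> / d\<close>, expand \<open>\<kappa>\<close> times
  the square norm of \<open>(\<alpha> / \<kappa>) r - div v\<close>. The mixed term is twice the
  energy by \<open>eq\<close>, and the last term is at most one energy, which leaves one energy on
  the other side. Applied to the difference of successive errors and, for convergence of the
  displacement, to the error itself.\<close>

lemma a_form_energy_bound:
  assumes v: "piecewise_C1 \<T> v" and r: "r \<in> L2_space \<Omega>" and "lam > 0" "\<mu> > 0"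
    and eq: "a_form \<Omega> lam \<mu> v v = \<alpha> * ip \<Omega> r (divg v)"
  shows "a_form \<Omega> lam \<mu> v v \<le> \<alpha>\<^sup>2 / (lam + 2 * \<mu> / real CARD('d)) * ip \<Omega> r r"
proof -
  define \<kappa> where "\<kappa> = lam + 2 * \<mu> / real CARD('d)"
  have \<kappa>: "\<kappa> > 0" using assms(3,4) by (auto simp: \<kappa>_def intro!: add_pos_nonneg)
  have "0 \<le> ip \<Omega> (\<lambda>x. (\<alpha> / \<kappa>) *\<^sub>R r x + (-1) *\<^sub>R divg v x) (\<lambda>x. (\<alpha> / \<kappa>) *\<^sub>R r x + (-1) *\<^sub>R divg v x)"
    by (rule ip_nonneg)
  also have "\<dots> = (\<alpha> / \<kappa>)\<^sup>2 * ip \<Omega> r r - 2 * (\<alpha> / \<kappa>) * ip \<Omega> r (divg v) + ip \<Omega> (divg v) (divg v)"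
    using ip_lincomb_self[OF r piecewise_C1_L2(2)[OF v], of "\<alpha> / \<kappa>" "-1"] by simp
  finally have "0 \<le> \<kappa> * ((\<alpha> / \<kappa>)\<^sup>2 * ip \<Omega> r r - 2 * (\<alpha> / \<kappa>) * ip \<Omega> r (divg v) + ip \<Omega> (divg v) (divg v))"
    using \<kappa> by simp
  also have "\<dots> = \<alpha>\<^sup>2 / \<kappa> * ip \<Omega> r r - 2 * (\<alpha> * ip \<Omega> r (divg v)) + \<kappa> * ip \<Omega> (divg v) (divg v)"
    using \<kappa> by (simp add: field_simps power2_eq_square)
  finally show ?thesis
    using divg_le_a_form[OF v, of \<mu> lam] assms(4) eq unfolding \<kappa>_def by linarith
qed

text \<open>The energy of \<open>v + t w\<close> is nonnegative at its minimizer in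
  \<open>t\<close>; \<open>pos\<close> makes this minimizer available.\<close>

lemma a_form_Cauchy_Schwarz:
  assumes v: "piecewise_C1 \<T> v" and w: "piecewise_C1 \<T> w" and "lam \<ge> 0" "\<mu> \<ge> 0"
    and pos: "a_form \<Omega> lam \<mu> w w > 0"
  shows "a_form \<Omega> lam \<mu> v w \<le> norm_A \<Omega> lam \<mu> v * norm_A \<Omega> lam \<mu> w"
proof -
  let ?a = "a_form \<Omega> lam \<mu>"
  define t where "t = - ?a v w / ?a w w"
  let ?z = "\<lambda>x. 1 *\<^sub>R v x + t *\<^sub>R w x"
  have z: "piecewise_C1 \<T> ?z" using v w by (rule piecewise_C1_lincomb)
  have "?a ?z ?z = ?a v ?z + t * ?a w ?z"
    using a_form_lincomb_left[OF v w z, of lam \<mu> 1 t] by simp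
  also have "?a v ?z = ?a v v + t * ?a v w"
    using a_form_lincomb_left[OF v w v, of lam \<mu> 1 t] by (simp add: a_form_commute)
  also have "?a w ?z = ?a v w + t * ?a w w"
    using a_form_lincomb_left[OF v w w, of lam \<mu> 1 t] by (simp add: a_form_commute)
  finally have "0 \<le> ?a v v + t * ?a v w + t * (?a v w + t * ?a w w)"
    using a_form_nonneg[OF assms(3,4), of \<Omega> ?z] by simp
  also have "\<dots> = ?a v v - (?a v w)\<^sup>2 / ?a w w"
    using pos by (simp add: t_def field_simps power2_eq_square)
  finally have "(?a v w)\<^sup>2 \<le> ?a v v * ?a w w"
    using pos by (simp add: field_simps)
  from real_le_rsqrt[OF this] show ?thesis by (simp add: norm_A_def real_sqrt_mult)
qed

lemma Q_space_L2: "q \<in> Q_space \<Omega> \<T> \<Longrightarrow> q \<in> L2_space \<Omega>"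
  by (simp add: Q_space_def H10_def)

lemma ip_Z_commute: "ip_Z \<Omega> \<T> p q = ip_Z \<Omega> \<T> q p"
  by (simp add: ip_Z_def ip_commute ip_lumped_commute)

lemma ip_Z_lincomb_left:
  assumes "p \<in> Q_space \<Omega> \<T>" "q \<in> Q_space \<Omega> \<T>" "r \<in> Q_space \<Omega> \<T>"
  shows "ip_Z \<Omega> \<T> (\<lambda>x. a *\<^sub>R p x + b *\<^sub>R q x) r = a * ip_Z \<Omega> \<T> p r + b * ip_Z \<Omega> \<T> q r"
  using assms[THEN Q_space_L2]
  by (simp add: ip_Z_def ip_lumped_lincomb_left ip_lincomb_left algebra_simps del: real_scaleR_def)

lemma norm_Z_sq_lincomb:
  assumes "p \<in> Q_space \<Omega> \<T>" "q \<in> Q_space \<Omega> \<T>"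
  shows "norm_Z_sq \<Omega> \<T> (\<lambda>x. a *\<^sub>R p x + b *\<^sub>R q x)
    = a\<^sup>2 * norm_Z_sq \<Omega> \<T> p + 2 * a * b * ip_Z \<Omega> \<T> p q + b\<^sup>2 * norm_Z_sq \<Omega> \<T> q"
proof -
  let ?r = "\<lambda>x. a *\<^sub>R p x + b *\<^sub>R q x"
  have "?r \<in> Q_space \<Omega> \<T>"
    using Q_space_lincomb[OF open_domain bounded_dom assms] .
  then have "ip_Z \<Omega> \<T> ?r ?r = a * ip_Z \<Omega> \<T> ?r p + b * ip_Z \<Omega> \<T> ?r q"
    using assms by (subst ip_Z_lincomb_left) (simp_all add: ip_Z_commute del: real_scaleR_def)
  then show ?thesis
    using assms by (simp add: norm_Z_sq_def ip_Z_lincomb_left ip_Z_commute[of q p] algebra_simps power2_eq_square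
        del: real_scaleR_def)
qed

text \<open>The upper spectral bound places a square below \<open>C\<^sub>2\<close> times this
  quantity, and \<open>C\<^sub>2\<close> is positive.\<close>

lemma norm_Z_sq_nonneg:
  assumes "spectral_equivalence \<Omega> \<T> C\<^sub>1 C\<^sub>2" "q \<in> Q_space \<Omega> \<T>"
  shows "0 \<le> norm_Z_sq \<Omega> \<T> q"
proof -
  have "0 \<le> C\<^sub>2 * norm_Z_sq \<Omega> \<T> q" "C\<^sub>2 > 0"
    using assms unfolding spectral_equivalence_def by (auto intro: order_trans[OF zero_le_power2])
  then show ?thesis by (simp add: zero_le_mult_iff)
qed

text \<open>By \<open>eq\<close> the inf-sup quotient is \<open>a(u, w)\<close> divided by
  \<open>\<alpha>\<close> and the energy norm of \<open>w\<close>, so Cauchy-Schwarz bounds the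
  supremum by the energy norm of \<open>u\<close> over \<open>\<alpha>\<close>. The upper spectral
  bound trades the mesh-weighted gradient for the Z-seminorm.\<close>

lemma inf_sup_lower_bound:
  assumes V: "V = V_linear \<Omega> \<T> \<or> V = V_mini \<Omega> \<T>" and u: "u \<in> V" and q: "q \<in> Q_space \<Omega> \<T>"
    and pos: "lam > 0" "\<mu> > 0" "\<alpha> > 0" "\<epsilon> > 0"
    and eq: "\<And>w. w \<in> V \<Longrightarrow> a_form \<Omega> lam \<mu> u w = \<alpha> * ip \<Omega> q (divg w)"
    and wis: "weak_inf_sup \<Omega> \<T> V lam \<mu> \<eta> \<epsilon>" and se: "spectral_equivalence \<Omega> \<T> C\<^sub>1 C\<^sub>2"
  shows "\<alpha> / sqrt (lam + 2 * \<mu> / real CARD('d)) *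
      (\<eta> * L2_norm \<Omega> q - \<epsilon> * sqrt (C\<^sub>2 * norm_Z_sq \<Omega> \<T> q)) \<le> norm_A \<Omega> lam \<mu> u"
proof -
  define s where "s = sqrt (lam + 2 * \<mu> / real CARD('d))"
  have s: "s > 0" using pos by (auto simp: s_def intro!: add_pos_nonneg)
  define X where "X r = \<eta> * L2_norm \<Omega> r - \<epsilon> * sqrt (C\<^sub>2 * norm_Z_sq \<Omega> \<T> r)" for r
  have X: "X r / s \<le> (SUP w\<in>V - {\<lambda>x. 0}. ip \<Omega> r (divg w) / norm_A \<Omega> lam \<mu> w)" (is "_ \<le> ?S r")
    if r: "r \<in> Q_space \<Omega> \<T>" for r
  proof -
    have "h_grad_norm \<T> r \<le> sqrt (C\<^sub>2 * norm_Z_sq \<Omega> \<T> r)"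
      using se r by (intro real_le_rsqrt) (simp add: spectral_equivalence_def)
    then have "X r / s \<le> \<eta> / s * L2_norm \<Omega> r - \<epsilon> / s * h_grad_norm \<T> r"
      using s pos by (simp add: X_def divide_simps)
    also have "\<dots> \<le> ?S r"
      using wis r unfolding weak_inf_sup_def s_def[symmetric] by blast
    finally show ?thesis .
  qed
  have nA: "0 \<le> norm_A \<Omega> lam \<mu> w" for w
    using pos by (simp add: norm_A_def a_form_nonneg)
  have "X q / s \<le> norm_A \<Omega> lam \<mu> u / \<alpha>"
  proof (cases "V - {\<lambda>x. 0} = {}")
    case True
    txt \<open>The supremum is then an unspecified constant; scaling \<open>q\<close> shows that the left-hand side
      of the inf-sup condition is nonpositive.\<close>
    have "X q \<le> 0"
    proof (rule ccontr)
      assume neg: "\<not> X q \<le> 0"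
      \<comment> \<open>Chosen so that the left-hand side, which is homogeneous in the scaling,
        takes the value \<open>\<bar>?S q\<bar> + 1\<close> and exceeds the constant.\<close>
      define t where "t = (\<bar>?S q\<bar> + 1) * s / X q"
      have t: "t > 0" using neg s by (simp add: t_def)
      let ?r = "\<lambda>x. t *\<^sub>R q x + 0 *\<^sub>R q x"
      have r: "?r \<in> Q_space \<Omega> \<T>"
        by (rule Q_space_lincomb[OF open_domain bounded_dom q q])
      have "L2_norm \<Omega> ?r = t * L2_norm \<Omega> q"
        using ip_lincomb_self[OF Q_space_L2[OF q] Q_space_L2[OF q], of t 0] t
        unfolding L2_norm_def by (simp add: real_sqrt_mult)
      moreover have "norm_Z_sq \<Omega> \<T> ?r = t\<^sup>2 * norm_Z_sq \<Omega> \<T> q"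
        using norm_Z_sq_lincomb[OF q q, of t 0] by simp
      ultimately have "X ?r = t * X q"
        using t unfolding X_def by (simp add: real_sqrt_mult algebra_simps)
      also have "\<dots> / s = \<bar>?S q\<bar> + 1" using neg s by (simp add: t_def)
      finally have "\<bar>?S q\<bar> + 1 \<le> ?S ?r" using X[OF r] by simp
      moreover have "?S ?r = ?S q" by (simp only: True image_empty)
      ultimately show False by linarith
    qed
    then show ?thesis using s pos nA[of u]
      by (meson divide_nonneg_pos divide_nonpos_pos order_trans)
  next
    case False
    have "ip \<Omega> q (divg w) / norm_A \<Omega> lam \<mu> w \<le> norm_A \<Omega> lam \<mu> u / \<alpha>" if w: "w \<in> V" for w
    proof (cases "a_form \<Omega> lam \<mu> w w > 0")
      case True
      then have p: "norm_A \<Omega> lam \<mu> w > 0" by (simp add: norm_A_def)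
      have "a_form \<Omega> lam \<mu> u w \<le> norm_A \<Omega> lam \<mu> u * norm_A \<Omega> lam \<mu> w"
        using piecewise_C1_spaces[OF V] u w True pos by (intro a_form_Cauchy_Schwarz) auto
      then show ?thesis using eq[OF w] p pos by (simp add: field_simps)
    next
      \<comment> \<open>Division by zero yields 0, so a nonzero field of zero energy contributes a
        harmless quotient.\<close>
      case False
      then have "norm_A \<Omega> lam \<mu> w = 0"
        using a_form_nonneg[of lam \<mu> \<Omega> w] pos by (simp add: norm_A_def)
      then show ?thesis using nA[of u] pos by simp
    qed
    then have "?S q \<le> norm_A \<Omega> lam \<mu> u / \<alpha>"
      using False by (intro cSUP_least) auto
    with X[OF q] show ?thesis by linarith
  qed
  then show ?thesis using s pos unfolding s_def[symmetric] X_def[symmetric] by (simp add: field_simps)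
qed

end

text \<open>Dictionary: \<open>x\<close> and \<open>y\<close> stand for the new and the old pressure
  error, a leading \<open>z\<close> marks the Z-product, \<open>dxx\<close> is the diffusion term,
  and the names in \<open>a\<close> are displacement energies. Doubling \<open>E\<close> and writing
  \<open>2 * (xx - xy)\<close> as \<open>xx - yy\<close> plus the square norm of the difference
  yields the nonnegative term that dominates the loss with factor \<open>m\<close>. The mixed Z-term
  is split evenly by \<open>Z\<close>, which produces \<open>\<bar>1 - \<gamma>\<bar>\<close> on
  both sides.\<close>

lemma energy_step:
  fixes xx xy yy zxx zxy zyy aii aij ajj :: real
  assumes E: "\<beta>i * xx + M * (xx - xy) + \<gamma> * L * zxx - (\<gamma> - 1) * L * zxy + dxx + aij = 0"
    and A: "aii - 2 * aij + ajj \<le> m * (xx - 2 * xy + yy)" "m \<le> M" "0 \<le> xx - 2 * xy + yy"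
    and nn: "0 \<le> \<beta>i" "0 \<le> xx" "0 \<le> dxx" "0 \<le> ajj" "0 \<le> L"
    and Z: "2 * \<bar>zxy\<bar> \<le> zxx + zyy"
  shows "M * xx + (2 * \<gamma> - \<bar>1 - \<gamma>\<bar>) * L * zxx + aii \<le> M * yy + \<bar>1 - \<gamma>\<bar> * L * zyy"
proof -
  have "m * (xx - 2 * xy + yy) \<le> M * (xx - 2 * xy + yy)"
    using A by (intro mult_right_mono) auto
  moreover have "2 * ((\<gamma> - 1) * L * zxy) \<le> \<bar>1 - \<gamma>\<bar> * L * (zxx + zyy)"
  proof -
    have "2 * ((\<gamma> - 1) * L * zxy) \<le> \<bar>2 * ((\<gamma> - 1) * L * zxy)\<bar>" by simp
    also have "\<dots> = \<bar>1 - \<gamma>\<bar> * L * (2 * \<bar>zxy\<bar>)"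
      using nn by (simp add: abs_mult abs_minus_commute)
    also have "\<dots> \<le> \<bar>1 - \<gamma>\<bar> * L * (zxx + zyy)"
      using nn Z by (intro mult_left_mono) auto
    finally show ?thesis .
  qed
  moreover have "0 \<le> \<beta>i * xx" using nn by simp
  ultimately show ?thesis using E A(1) nn by (simp only: algebra_simps)
qed

text \<open>For \<open>\<gamma> > 1/2\<close> the difference
  \<open>\<gamma> - \<bar>1 - \<gamma>\<bar>\<close> is positive, and so is the prescribed lower
  bound.\<close>

lemma theta_star_pos:
  assumes "is_theta_star \<gamma> \<omega> \<eta> \<epsilon> C \<theta>" "1/2 < \<gamma>" "\<omega> \<ge> 1" "\<epsilon> > 0" "C > 0"
  shows "\<theta> > 0"
proof -
  have "\<gamma> - \<bar>1 - \<gamma>\<bar> > 0" using assms(2) by (simp add: abs_if)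
  then have "0 < \<epsilon>\<^sup>2 * C * \<gamma> / (4 * \<omega> * (\<gamma> - \<bar>1 - \<gamma>\<bar>))" using assms by simp
  also have "\<dots> \<le> \<theta>" using assms(1) by (simp add: is_theta_star_def)
  finally show ?thesis .
qed

text \<open>At the lower bound for \<open>\<theta>\<close> the quadratic polynomial is nonpositive, so that the intermediate
  value theorem yields a root above it.\<close>

lemma theta_star_exists:
  assumes "1/2 < \<gamma>" "\<omega> \<ge> 1" "\<epsilon> > 0" "C > 0"
  shows "\<exists>\<theta>. is_theta_star \<gamma> \<omega> \<eta> \<epsilon> C \<theta>"
proof -
  define k where "k = (\<gamma> - \<bar>1 - \<gamma>\<bar>) / \<gamma>"
  define e where "e = \<epsilon>\<^sup>2 * C / (4 * \<omega>)"
  define n where "n = \<eta>\<^sup>2 * \<bar>1 - \<gamma>\<bar> / (2 * \<omega> * \<gamma>)"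
  have g: "\<gamma> - \<bar>1 - \<gamma>\<bar> > 0" using assms(1) by (simp add: abs_if)
  have k: "k > 0" and e: "e > 0" and n: "n \<ge> 0"
    using assms g by (auto simp: k_def e_def n_def)
  define P where "P \<theta> = 2 * k * \<theta>\<^sup>2 + (k - n - 2 * e) * \<theta> - e" for \<theta>
  define t0 where "t0 = e / k"
  have t0: "t0 > 0" using k e by (simp add: t0_def)
  have "P t0 = - n * t0"
    using k by (simp add: P_def t0_def power2_eq_square field_simps)
  then have lo: "P t0 \<le> 0" using n t0 by simp
  \<comment> \<open>Large enough to make both summands of \<open>P t1\<close> below nonnegative: the
    bracket becomes \<open>2 * e\<close> and the remainder \<open>(n + 2 * e) / 2\<close>.\<close>
  define t1 where "t1 = t0 + (n + 2 * e) / (2 * k)"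
  have le: "t0 \<le> t1" using n e k by (simp add: t1_def)
  have "P t1 = t1 * (2 * k * t1 - n - 2 * e) + (k * t1 - e)"
    by (simp add: P_def power2_eq_square algebra_simps)
  also have "2 * k * t1 - n - 2 * e = 2 * e"
    using k by (simp add: t1_def t0_def field_simps)
  also have "k * t1 - e = (n + 2 * e) / 2"
    using k by (simp add: t1_def t0_def field_simps)
  finally have hi: "P t1 \<ge> 0" using t0 le n e by simp
  have "\<exists>\<theta>. t0 \<le> \<theta> \<and> \<theta> \<le> t1 \<and> P \<theta> = 0"
    using lo hi le by (intro IVT) (auto simp: P_def intro!: continuous_intros)
  then obtain \<theta> where \<theta>: "t0 \<le> \<theta>" "P \<theta> = 0" by blast
  have "t0 = \<epsilon>\<^sup>2 * C * \<gamma> / (4 * \<omega> * (\<gamma> - \<bar>1 - \<gamma>\<bar>))"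
    by (simp add: t0_def e_def k_def)
  moreover have "P \<theta> = 2 * (\<gamma> - \<bar>1 - \<gamma>\<bar>) / \<gamma> * \<theta>\<^sup>2
     + ((\<gamma> - \<bar>1 - \<gamma>\<bar>) / \<gamma> - \<eta>\<^sup>2 * \<bar>1 - \<gamma>\<bar> / (2 * \<omega> * \<gamma>) - \<epsilon>\<^sup>2 * C / (2 * \<omega>)) * \<theta>
     - \<epsilon>\<^sup>2 * C / (4 * \<omega>)"
    by (simp add: P_def k_def e_def n_def)
  ultimately show ?thesis using \<theta> unfolding is_theta_star_def by metis
qed

text \<open>Write \<open>A\<close> for \<open>\<bar>1 - \<gamma>\<bar>\<close> and \<open>d\<close>
  for \<open>\<gamma> - \<gamma>2\<close>. After division by \<open>\<omega> * m\<close>, the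
  displacement energy in the estimate is replaced by its lower bound \<open>r * xx - s * zz\<close>.
  This leaves \<open>(1 + r) * xx + ((2 * \<gamma> - A) / d - s) * zz\<close>, and the equation for
  \<open>\<theta>\<close> makes the second coefficient at least \<open>(1 + r) * A / d\<close>, so
  that the common factor \<open>1 + r\<close> comes out.\<close>

lemma contraction_step:
  fixes xx zz yy ww aa m M L :: real
  assumes \<theta>: "is_theta_star \<gamma> \<omega> \<eta> \<epsilon> C \<theta>" and g: "1/2 < \<gamma>" "\<gamma>2 < \<gamma>" "0 \<le> \<gamma>2"
    and w: "\<omega> \<ge> 1" "\<epsilon> > 0" "C > 0" "\<eta> > 0" and m: "m > 0" and L: "(\<gamma> - \<gamma>2) * L = \<omega> * m"
    and nn: "0 \<le> xx" "0 \<le> zz" "0 \<le> aa"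
    and energy: "\<omega> * m * xx + (2 * \<gamma> - \<bar>1 - \<gamma>\<bar>) * L * zz + aa \<le> \<omega> * m * yy + \<bar>1 - \<gamma>\<bar> * L * ww"
    and infsup: "sqrt m * (\<eta> * sqrt xx - \<epsilon> * sqrt (C * zz)) \<le> sqrt aa"
  shows "xx + \<bar>1 - \<gamma>\<bar> / (\<gamma> - \<gamma>2) * zz
    \<le> 1 / (1 + \<eta>\<^sup>2 / (\<omega> * (1 + 2 * \<theta>))) * (yy + \<bar>1 - \<gamma>\<bar> / (\<gamma> - \<gamma>2) * ww)"
proof -
  define A where "A = \<bar>1 - \<gamma>\<bar>"
  define d where "d = \<gamma> - \<gamma>2"
  \<comment> \<open>\<open>r\<close> and \<open>s\<close> are what remains of the two Young weights
    after division by \<open>\<omega> * m * (1 + 2 * \<theta>)\<close>, as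
    \<open>1 + 1 / (2 * \<theta>)\<close> equals
    \<open>(1 + 2 * \<theta>) / (2 * \<theta>)\<close>.\<close>
  define r where "r = \<eta>\<^sup>2 / (\<omega> * (1 + 2 * \<theta>))"
  define s where "s = \<epsilon>\<^sup>2 * C / (2 * \<omega> * \<theta>)"
  have th: "\<theta> > 0" using theta_star_pos[OF \<theta> g(1) w(1-3)] .
  have d: "d > 0" and g0: "\<gamma> > 0" and r: "r \<ge> 0" and s: "s \<ge> 0" and wm: "\<omega> * m > 0"
    using g w th m by (auto simp: d_def r_def s_def)
  have Leq: "L = \<omega> * m / d" using L d by (simp add: d_def field_simps)
  have step1: "xx + (2 * \<gamma> - A) / d * zz + aa / (\<omega> * m) \<le> yy + A / d * ww"
  proof -
    have "\<omega> * m * (xx + (2 * \<gamma> - A) / d * zz + aa / (\<omega> * m)) \<le> \<omega> * m * (yy + A / d * ww)"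
      using energy wm by (simp add: Leq A_def[symmetric] distrib_left)
        (simp add: field_simps)
    then show ?thesis using wm by (simp only: mult_le_cancel_left_pos)
  qed
  have young: "\<eta>\<^sup>2 * m * xx \<le> (1 + 2 * \<theta>) * aa + (1 + 1 / (2 * \<theta>)) * (\<epsilon>\<^sup>2 * C * m * zz)"
  proof -
    define a where "a = sqrt aa"
    define b where "b = \<epsilon> * sqrt m * sqrt (C * zz)"
    \<comment> \<open>The left-hand side of \<open>infsup\<close> may be negative, so the
      \<epsilon>-term changes sides before squaring.\<close>
    have "\<eta> * sqrt m * sqrt xx \<le> a + b" using infsup by (simp add: a_def b_def algebra_simps)
    moreover have "0 \<le> \<eta> * sqrt m * sqrt xx" using w m nn by simp
    ultimately have "(\<eta> * sqrt m * sqrt xx)\<^sup>2 \<le> (a + b)\<^sup>2" by (intro power_mono)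
    also have "\<dots> = (1 + 2 * \<theta>) * a\<^sup>2 + (1 + 1 / (2 * \<theta>)) * b\<^sup>2 - (2 * \<theta> * a - b)\<^sup>2 / (2 * \<theta>)"
      using th by (simp add: field_simps power2_eq_square)
    also have "\<dots> \<le> (1 + 2 * \<theta>) * a\<^sup>2 + (1 + 1 / (2 * \<theta>)) * b\<^sup>2" using th by simp
    finally show ?thesis using nn m w by (simp add: a_def b_def power_mult_distrib mult_ac)
  qed
  have step2: "r * xx - s * zz \<le> aa / (\<omega> * m)"
  proof -
    have "r * xx = \<eta>\<^sup>2 * m * xx / (\<omega> * m * (1 + 2 * \<theta>))"
      using m by (simp add: r_def)
    also have "\<dots> \<le> ((1 + 2 * \<theta>) * aa + (1 + 1 / (2 * \<theta>)) * (\<epsilon>\<^sup>2 * C * m * zz)) / (\<omega> * m * (1 + 2 * \<theta>))"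
      using young wm th by (intro divide_right_mono) auto
    also have "\<dots> = (1 + 2 * \<theta>) * aa / (\<omega> * m * (1 + 2 * \<theta>))
        + (1 + 1 / (2 * \<theta>)) * (\<epsilon>\<^sup>2 * C * m * zz) / (\<omega> * m * (1 + 2 * \<theta>))"
      by (rule add_divide_distrib)
    also have "(1 + 2 * \<theta>) * aa / (\<omega> * m * (1 + 2 * \<theta>)) = aa / (\<omega> * m)"
      using th by simp
    also have "(1 + 1 / (2 * \<theta>)) = (1 + 2 * \<theta>) / (2 * \<theta>)" using th by (simp add: field_simps)
    also have "(1 + 2 * \<theta>) / (2 * \<theta>) * (\<epsilon>\<^sup>2 * C * m * zz) / (\<omega> * m * (1 + 2 * \<theta>)) = s * zz"
      using th m w by (simp add: s_def divide_simps)
    finally show ?thesis by simp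
  qed
  have step3: "A / d * (1 + r) \<le> (2 * \<gamma> - A) / d - s"
  proof -
    have q: "2 * (\<gamma> - A) / \<gamma> * \<theta>\<^sup>2 + ((\<gamma> - A) / \<gamma> - \<eta>\<^sup>2 * A / (2 * \<omega> * \<gamma>) - \<epsilon>\<^sup>2 * C / (2 * \<omega>)) * \<theta>
       - \<epsilon>\<^sup>2 * C / (4 * \<omega>) = 0"
      using \<theta> by (simp add: is_theta_star_def A_def)
    have e1: "\<eta>\<^sup>2 * A / (2 * \<omega> * \<gamma>) = A * r * (1 + 2 * \<theta>) / (2 * \<gamma>)"
      using th w g0 by (simp add: r_def divide_simps)
    have e2: "\<epsilon>\<^sup>2 * C / (2 * \<omega>) = s * \<theta>" "\<epsilon>\<^sup>2 * C / (4 * \<omega>) = s * \<theta> / 2"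
      using th w by (simp_all add: s_def divide_simps)
    \<comment> \<open>Expressed through \<open>r\<close> and \<open>s\<close>, the quadratic
      polynomial in \<theta> is this positive factor times the balance
      \<open>2 * (\<gamma> - A) - A * r - \<gamma> * s\<close>, which must therefore vanish.\<close>
    have "\<theta> * (1 + 2 * \<theta>) / (2 * \<gamma>) * (2 * (\<gamma> - A) - A * r - \<gamma> * s)
        = 2 * (\<gamma> - A) / \<gamma> * \<theta>\<^sup>2 + ((\<gamma> - A) / \<gamma> - A * r * (1 + 2 * \<theta>) / (2 * \<gamma>) - s * \<theta>) * \<theta>
          - s * \<theta> / 2"
      using g0 by (simp add: field_simps power2_eq_square)
    also have "\<dots> = 0" using q unfolding e1 e2 .
    finally have "2 * (\<gamma> - A) = A * r + \<gamma> * s" using th g0 by simp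
    \<comment> \<open>The balance carries \<open>\<gamma>\<close> where the weights call for
      \<open>d\<close>; \<open>\<gamma>2 \<ge> 0\<close> settles the direction.\<close>
    moreover have "d * s \<le> \<gamma> * s" using s g by (intro mult_right_mono) (auto simp: d_def)
    ultimately have "A * (1 + r) \<le> 2 * \<gamma> - A - d * s" by (simp add: algebra_simps)
    then have "A * (1 + r) / d \<le> (2 * \<gamma> - A - d * s) / d" using d by (intro divide_right_mono) auto
    then show ?thesis using d by (simp add: diff_divide_distrib)
  qed
  have "(1 + r) * (xx + A / d * zz) \<le> yy + A / d * ww"
  proof -
    have "A / d * (1 + r) * zz \<le> ((2 * \<gamma> - A) / d - s) * zz"
      using step3 nn by (intro mult_right_mono)
    then show ?thesis using step1 step2 by (simp add: algebra_simps)
  qed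
  then have "xx + A / d * zz \<le> (yy + A / d * ww) / (1 + r)"
    using r by (simp add: pos_le_divide_eq mult.commute)
  then show ?thesis by (simp add: A_def d_def r_def)
qed

section \<open>Error equations\<close>

context mesh
begin

lemma ip_diff_quot_left:
  assumes "f \<in> L2_space \<Omega>" "f' \<in> L2_space \<Omega>" "q \<in> L2_space \<Omega>"
  shows "ip \<Omega> (diff_quot \<tau> f f') q = (ip \<Omega> f q - ip \<Omega> f' q) / \<tau>"
  unfolding diff_quot_eq ip_lincomb_left[OF assms] by (simp add: diff_divide_distrib)

lemma ip_lumped_diff_quot_left:
  "ip_lumped \<T> (diff_quot \<tau> f f') q = (ip_lumped \<T> f q - ip_lumped \<T> f' q) / \<tau>"
  unfolding diff_quot_eq ip_lumped_lincomb_left by (simp add: diff_divide_distrib)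

lemma ip_divg_diff_quot_left:
  assumes "piecewise_C1 \<T> v" "piecewise_C1 \<T> v'" "q \<in> L2_space \<Omega>"
  shows "ip \<Omega> (divg (diff_quot \<tau> v v')) q = (ip \<Omega> (divg v) q - ip \<Omega> (divg v') q) / \<tau>"
  unfolding diff_quot_eq ip_divg_lincomb[OF assms] by (simp add: diff_divide_distrib)

lemma Q_space_diff:
  assumes "p \<in> Q_space \<Omega> \<T>" "q \<in> Q_space \<Omega> \<T>"
  shows "(\<lambda>x. p x - q x) \<in> Q_space \<Omega> \<T>"
  using Q_space_lincomb[OF open_domain bounded_dom assms, of 1 "-1"] by simp

lemma V_diff:
  assumes "V = V_linear \<Omega> \<T> \<or> V = V_mini \<Omega> \<T>" "v \<in> V" "w \<in> V"
  shows "(\<lambda>x. v x - w x) \<in> V"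
  using V_lincomb[OF assms, of 1 "-1"] by simp

text \<open>Both equations are multiplied by \<open>\<tau>\<close> and subtracted, with the lumped
  product split into the L2 product and the Z-product. The L2 weights on the right of the iteration
  add up to \<open>\<gamma>\<^sub>1 - \<gamma>\<^sub>2\<close>. The scheme contributes Z-weight 1,
  and since \<open>\<gamma>\<^sub>1 = (\<gamma>\<^sub>1 - 1) + 1\<close> the data \<open>p'\<close>
  and \<open>p\<close> recombine into errors alone.\<close>

lemma pressure_error_equation:
  assumes p: "p \<in> Q_space \<Omega> \<T>" "p' \<in> Q_space \<Omega> \<T>" "pk \<in> Q_space \<Omega> \<T>" "pj \<in> Q_space \<Omega> \<T>"
    and u: "piecewise_C1 \<T> u" "piecewise_C1 \<T> u'" "piecewise_C1 \<T> uj"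
    and q: "q \<in> Q_space \<Omega> \<T>" and \<tau>: "\<tau> > 0"
    and scheme: "\<beta>i * ip \<Omega> (diff_quot \<tau> p p') q + \<alpha> * ip \<Omega> (divg (diff_quot \<tau> u u')) q
        + ap_form \<Omega> K p q + L * ip_lumped \<T> (diff_quot \<tau> p p') q - L * ip \<Omega> (diff_quot \<tau> p p') q
        = ip \<Omega> g q"
    and step: "\<beta>i * ip \<Omega> (diff_quot \<tau> pk p') q + \<gamma>\<^sub>1 * L * ip_lumped \<T> (diff_quot \<tau> pk p') q
        - \<gamma>\<^sub>2 * L * ip \<Omega> (diff_quot \<tau> pk p') q + ap_form \<Omega> K pk q
        = (1 - \<gamma>\<^sub>2) * L * ip \<Omega> (diff_quot \<tau> pj p') q
          + (\<gamma>\<^sub>1 - 1) * L * ip_lumped \<T> (diff_quot \<tau> pj p') q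
          - \<alpha> * ip \<Omega> (divg (diff_quot \<tau> uj u')) q + ip \<Omega> g q"
  defines "ei \<equiv> \<lambda>x. pk x - p x" and "ej \<equiv> \<lambda>x. pj x - p x"
  shows "\<beta>i * ip \<Omega> ei q + (\<gamma>\<^sub>1 - \<gamma>\<^sub>2) * L * (ip \<Omega> ei q - ip \<Omega> ej q) + \<gamma>\<^sub>1 * L * ip_Z \<Omega> \<T> ei q
      - (\<gamma>\<^sub>1 - 1) * L * ip_Z \<Omega> \<T> ej q + \<tau> * ap_form \<Omega> K ei q
      + \<alpha> * ip \<Omega> (divg (\<lambda>x. uj x - u x)) q = 0"
proof -
  note L2 = p[THEN Q_space_L2] q[THEN Q_space_L2]
  have [simp]: "ip \<Omega> ei q = ip \<Omega> pk q - ip \<Omega> p q" "ip \<Omega> ej q = ip \<Omega> pj q - ip \<Omega> p q"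
    "ip_Z \<Omega> \<T> ei q = ip_Z \<Omega> \<T> pk q - ip_Z \<Omega> \<T> p q" "ip_Z \<Omega> \<T> ej q = ip_Z \<Omega> \<T> pj q - ip_Z \<Omega> \<T> p q"
    "ap_form \<Omega> K ei q = ap_form \<Omega> K pk q - ap_form \<Omega> K p q"
    "ip \<Omega> (divg (\<lambda>x. uj x - u x)) q = ip \<Omega> (divg uj) q - ip \<Omega> (divg u) q"
    using ip_lincomb_left[of pk \<Omega> p q 1 "-1"] ip_lincomb_left[of pj \<Omega> p q 1 "-1"]
      ip_Z_lincomb_left[of pk p q 1 "-1"] ip_Z_lincomb_left[of pj p q 1 "-1"]
      ap_form_lincomb_left[of pk p q K 1 "-1"] ip_divg_lincomb[of uj u q 1 "-1"] p q L2 u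
    by (simp_all add: ei_def ej_def)
  have lump: "ip_lumped \<T> s q = ip \<Omega> s q + ip_Z \<Omega> \<T> s q" for s
    by (simp add: ip_Z_def)
  note dq = ip_diff_quot_left ip_lumped_diff_quot_left ip_divg_diff_quot_left
  have cancel: "\<tau> * (y * (z / \<tau>)) = y * z" for y z using \<tau> by simp
  have 1: "\<beta>i * (ip \<Omega> p q - ip \<Omega> p' q) + \<alpha> * (ip \<Omega> (divg u) q - ip \<Omega> (divg u') q)
      + \<tau> * ap_form \<Omega> K p q + L * (ip_Z \<Omega> \<T> p q - ip_Z \<Omega> \<T> p' q) = \<tau> * ip \<Omega> g q"
    using arg_cong[OF scheme, of "\<lambda>z. \<tau> * z"]
    by (simp only: dq L2 u distrib_left right_diff_distrib cancel) (simp add: lump algebra_simps)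
  have 2: "\<beta>i * (ip \<Omega> pk q - ip \<Omega> p' q) + (\<gamma>\<^sub>1 - \<gamma>\<^sub>2) * L * (ip \<Omega> pk q - ip \<Omega> p' q)
      + \<gamma>\<^sub>1 * L * (ip_Z \<Omega> \<T> pk q - ip_Z \<Omega> \<T> p' q) + \<tau> * ap_form \<Omega> K pk q
      = (\<gamma>\<^sub>1 - \<gamma>\<^sub>2) * L * (ip \<Omega> pj q - ip \<Omega> p' q) + (\<gamma>\<^sub>1 - 1) * L * (ip_Z \<Omega> \<T> pj q - ip_Z \<Omega> \<T> p' q)
        - \<alpha> * (ip \<Omega> (divg uj) q - ip \<Omega> (divg u') q) + \<tau> * ip \<Omega> g q"
    using arg_cong[OF step, of "\<lambda>z. \<tau> * z"]
    by (simp only: dq L2 u distrib_left right_diff_distrib cancel) (simp add: lump algebra_simps)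
  from 1 2 show ?thesis by (simp add: algebra_simps)
qed

lemma momentum_error_equation:
  assumes V: "V = V_linear \<Omega> \<T> \<or> V = V_mini \<Omega> \<T>"
    and u: "ui \<in> V" "u \<in> V" and p: "pk \<in> Q_space \<Omega> \<T>" "p \<in> Q_space \<Omega> \<T>"
    and eq: "momentum_equation \<Omega> V lam \<mu> \<alpha> f ui pk" "momentum_equation \<Omega> V lam \<mu> \<alpha> f u p"
    and v: "v \<in> V"
  shows "a_form \<Omega> lam \<mu> (\<lambda>x. ui x - u x) v = \<alpha> * ip \<Omega> (\<lambda>x. pk x - p x) (divg v)"
proof -
  note C1 = piecewise_C1_spaces[OF V]
  have "a_form \<Omega> lam \<mu> (\<lambda>x. ui x - u x) v = a_form \<Omega> lam \<mu> ui v - a_form \<Omega> lam \<mu> u v"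
    using a_form_lincomb_left[OF C1[OF u(1)] C1[OF u(2)] C1[OF v], of lam \<mu> 1 "-1"] by simp
  moreover have "ip \<Omega> (\<lambda>x. pk x - p x) (divg v) = ip \<Omega> pk (divg v) - ip \<Omega> p (divg v)"
    using ip_lincomb_left[OF Q_space_L2[OF p(1)] Q_space_L2[OF p(2)] piecewise_C1_L2(2)[OF C1[OF v]], of 1 "-1"]
    by simp
  moreover have "a_form \<Omega> lam \<mu> ui v - \<alpha> * ip \<Omega> pk (divg v) = a_form \<Omega> lam \<mu> u v - \<alpha> * ip \<Omega> p (divg v)"
    using eq v by (simp add: momentum_equation_def)
  ultimately show ?thesis by (simp add: right_diff_distrib)
qed

text \<open>\<open>eqi\<close> tested with \<open>wj\<close> identifies the coupling term. By
  linearity \<open>wi - wj\<close> solves the momentum relation driven by \<open>ei - ej\<close>, so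
  \<open>a_form_energy_bound\<close> applies to it; this is where \<open>eqj\<close> is
  indispensable.\<close>

lemma error_energy_step:
  assumes V: "V = V_linear \<Omega> \<T> \<or> V = V_mini \<Omega> \<T>" and pos: "lam > 0" "\<mu> > 0" "K > 0" "\<tau> > 0" "\<beta>i \<ge> 0"
    and se: "spectral_equivalence \<Omega> \<T> C\<^sub>1 C\<^sub>2" and L: "L \<ge> 0"
    and M: "\<alpha>\<^sup>2 / (lam + 2 * \<mu> / real CARD('d)) \<le> M"
    and e: "ei \<in> Q_space \<Omega> \<T>" "ej \<in> Q_space \<Omega> \<T>" and w: "wi \<in> V" "wj \<in> V"
    and eqi: "\<And>v. v \<in> V \<Longrightarrow> a_form \<Omega> lam \<mu> wi v = \<alpha> * ip \<Omega> ei (divg v)"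
    and eqj: "\<And>v. v \<in> V \<Longrightarrow> a_form \<Omega> lam \<mu> wj v = \<alpha> * ip \<Omega> ej (divg v)"
    and err: "\<beta>i * ip \<Omega> ei ei + M * (ip \<Omega> ei ei - ip \<Omega> ej ei) + \<gamma> * L * ip_Z \<Omega> \<T> ei ei
      - (\<gamma> - 1) * L * ip_Z \<Omega> \<T> ej ei + \<tau> * ap_form \<Omega> K ei ei + \<alpha> * ip \<Omega> (divg wj) ei = 0"
  shows "M * ip \<Omega> ei ei + (2 * \<gamma> - \<bar>1 - \<gamma>\<bar>) * L * norm_Z_sq \<Omega> \<T> ei + a_form \<Omega> lam \<mu> wi wi
    \<le> M * ip \<Omega> ej ej + \<bar>1 - \<gamma>\<bar> * L * norm_Z_sq \<Omega> \<T> ej"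
proof (rule energy_step[where dxx = "\<tau> * ap_form \<Omega> K ei ei" and xy = "ip \<Omega> ej ei" and zxy = "ip_Z \<Omega> \<T> ej ei"
      and aij = "\<alpha> * ip \<Omega> (divg wj) ei" and ajj = "a_form \<Omega> lam \<mu> wj wj"
      and m = "\<alpha>\<^sup>2 / (lam + 2 * \<mu> / real CARD('d))"])
  let ?a = "a_form \<Omega> lam \<mu>"
  note L2 = e[THEN Q_space_L2]
  note C1 = w[THEN piecewise_C1_spaces[OF V]]
  let ?r = "\<lambda>x. 1 *\<^sub>R ei x + (-1) *\<^sub>R ej x" and ?w = "\<lambda>x. 1 *\<^sub>R wi x + (-1) *\<^sub>R wj x"
  have wV: "?w \<in> V" using V_lincomb[OF V w] .
  have a: "?a ?w v = ?a wi v - ?a wj v" if "v \<in> V" for v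
    using a_form_lincomb_left[OF C1 piecewise_C1_spaces[OF V that], of lam \<mu> 1 "-1"] by simp
  have "?a ?w ?w = \<alpha> * ip \<Omega> ?r (divg ?w)"
    unfolding a[OF wV] eqi[OF wV] eqj[OF wV]
    using ip_lincomb_left[OF L2 piecewise_C1_L2(2)[OF piecewise_C1_spaces[OF V wV]], of 1 "-1"]
    by (simp add: right_diff_distrib)
  then have "?a ?w ?w \<le> \<alpha>\<^sup>2 / (lam + 2 * \<mu> / real CARD('d)) * ip \<Omega> ?r ?r"
    using pos by (intro a_form_energy_bound piecewise_C1_spaces[OF V wV] L2_lincomb L2)
  moreover have "?a ?w ?w = ?a ?w wi - ?a ?w wj"
    using a[OF wV] a_form_commute[of \<Omega> lam \<mu> ?w wi] a_form_commute[of \<Omega> lam \<mu> ?w wj] by linarith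
  then have "?a ?w ?w = ?a wi wi - 2 * ?a wi wj + ?a wj wj"
    unfolding a[OF w(1)] a[OF w(2)] a_form_commute[of \<Omega> lam \<mu> wj wi] by linarith
  moreover have "?a wi wj = \<alpha> * ip \<Omega> (divg wj) ei" using eqi[OF w(2)] by (simp add: ip_commute)
  moreover have r: "ip \<Omega> ?r ?r = ip \<Omega> ei ei - 2 * ip \<Omega> ej ei + ip \<Omega> ej ej"
    using ip_lincomb_self[OF L2, of 1 "-1"] by (simp add: ip_commute[of _ ej ei])
  ultimately show "?a wi wi - 2 * (\<alpha> * ip \<Omega> (divg wj) ei) + ?a wj wj
      \<le> \<alpha>\<^sup>2 / (lam + 2 * \<mu> / real CARD('d)) * (ip \<Omega> ei ei - 2 * ip \<Omega> ej ei + ip \<Omega> ej ej)"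
    by simp
  show "0 \<le> ip \<Omega> ei ei - 2 * ip \<Omega> ej ei + ip \<Omega> ej ej" unfolding r[symmetric] by (rule ip_nonneg)
  \<comment> \<open>Nonnegativity at the sum and at the difference of the two errors bounds the
    mixed Z-product from both sides.\<close>
  have "0 \<le> norm_Z_sq \<Omega> \<T> (\<lambda>x. 1 *\<^sub>R ej x + b *\<^sub>R ei x)" for b
    by (intro norm_Z_sq_nonneg[OF se] Q_space_lincomb open_domain bounded_dom e)
  from this[of 1] this[of "-1"]
  show "2 * \<bar>ip_Z \<Omega> \<T> ej ei\<bar> \<le> norm_Z_sq \<Omega> \<T> ei + norm_Z_sq \<Omega> \<T> ej"
    unfolding norm_Z_sq_lincomb[OF e(2,1)] by simp
qed (use err M pos L in \<open>auto simp: norm_Z_sq_def ip_nonneg ap_form_nonneg a_form_nonneg\<close>)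

end

text \<open>The contraction is stated for every admissible root; the separate existence claim shows
  that it is not vacuous. Only at \<open>i = 1\<close> is the preceding iterate the initial guess,
  hence the premise there.\<close>

theorem theorem3:
  fixes \<Omega> :: "(real^'d::finite) set" and \<T> :: "(real^'d) set set"
    and V :: "(real^'d \<Rightarrow> real^'d) set"
    and lam \<mu> \<alpha> \<beta>i K \<tau> L \<gamma>\<^sub>1 \<gamma>\<^sub>2 \<omega> \<eta> \<epsilon> C\<^sub>1 C\<^sub>2 :: real
    and f :: "real^'d \<Rightarrow> real^'d" and g :: "real^'d \<Rightarrow> real"
    and u' u :: "real^'d \<Rightarrow> real^'d" and p' p :: "real^'d \<Rightarrow> real"
    and us :: "nat \<Rightarrow> real^'d \<Rightarrow> real^'d" and ps :: "nat \<Rightarrow> real^'d \<Rightarrow> real"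
  defines "eu \<equiv> \<lambda>i x. us i x - u x" and "ep \<equiv> \<lambda>i x. ps i x - p x"
  assumes "CARD('d) \<le> 3" and "bounded_domain \<Omega>" and "simplicial_partition \<Omega> \<T>"
    and "V = V_linear \<Omega> \<T> \<or> V = V_mini \<Omega> \<T>"
    and "lam > 0" and "\<mu> > 0" and "\<alpha> > 0" and "\<beta>i \<ge> 0" and "K > 0" and "\<tau> > 0"
    and "f \<in> L2_space \<Omega>" and "g \<in> L2_space \<Omega>"
    and "u' \<in> V" and "p' \<in> Q_space \<Omega> \<T>"
    and "stabilized_scheme \<Omega> \<T> V lam \<mu> \<alpha> \<beta>i K \<tau> L f g u' p' u p"
    and "two_parameter_iteration \<Omega> \<T> V lam \<mu> \<alpha> \<beta>i K \<tau> L \<gamma>\<^sub>1 \<gamma>\<^sub>2 f g u' p' us ps"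
    and "\<eta> > 0" and "\<epsilon> > 0" and "weak_inf_sup \<Omega> \<T> V lam \<mu> \<eta> \<epsilon>"
    and "spectral_equivalence \<Omega> \<T> C\<^sub>1 C\<^sub>2"
    and "1/2 < \<gamma>\<^sub>1" and "\<gamma>\<^sub>1 \<le> 2" and "\<gamma>\<^sub>1 > \<gamma>\<^sub>2" and "\<gamma>\<^sub>2 \<ge> 0"
    and "\<omega> \<ge> 1" and "(\<gamma>\<^sub>1 - \<gamma>\<^sub>2) * L = \<omega> * (\<alpha>\<^sup>2 / (lam + 2 * \<mu> / real CARD('d)))"
  shows "(\<lambda>i. L2_norm \<Omega> (ep i)) \<longlonglongrightarrow> 0 \<and> (\<lambda>i. norm_A \<Omega> lam \<mu> (eu i)) \<longlonglongrightarrow> 0 \<and>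
    (\<exists>\<theta>. is_theta_star \<gamma>\<^sub>1 \<omega> \<eta> \<epsilon> C\<^sub>2 \<theta>) \<and>
    (\<forall>\<theta>. is_theta_star \<gamma>\<^sub>1 \<omega> \<eta> \<epsilon> C\<^sub>2 \<theta> \<longrightarrow>
      (\<forall>i\<ge>1. (i = 1 \<longrightarrow> momentum_equation \<Omega> V lam \<mu> \<alpha> f u' p') \<longrightarrow>
        (L2_norm \<Omega> (ep i))\<^sup>2 + \<bar>1 - \<gamma>\<^sub>1\<bar> / (\<gamma>\<^sub>1 - \<gamma>\<^sub>2) * norm_Z_sq \<Omega> \<T> (ep i)
        \<le> 1 / (1 + \<eta>\<^sup>2 / (\<omega> * (1 + 2 * \<theta>))) *
          ((L2_norm \<Omega> (ep (i - 1)))\<^sup>2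
           + \<bar>1 - \<gamma>\<^sub>1\<bar> / (\<gamma>\<^sub>1 - \<gamma>\<^sub>2) * norm_Z_sq \<Omega> \<T> (ep (i - 1)))))"
proof -
  interpret mesh \<Omega> \<T> using assms(4,5) by unfold_locales
  note V = \<open>V = V_linear \<Omega> \<T> \<or> V = V_mini \<Omega> \<T>\<close>
  note pos = \<open>lam > 0\<close> \<open>\<mu> > 0\<close> \<open>\<alpha> > 0\<close> \<open>\<beta>i \<ge> 0\<close> \<open>K > 0\<close> \<open>\<tau> > 0\<close> \<open>\<eta> > 0\<close> \<open>\<epsilon> > 0\<close> \<open>\<omega> \<ge> 1\<close>
  note gam = \<open>1/2 < \<gamma>\<^sub>1\<close> \<open>\<gamma>\<^sub>1 > \<gamma>\<^sub>2\<close> \<open>\<gamma>\<^sub>2 \<ge> 0\<close>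
  note scheme = \<open>stabilized_scheme \<Omega> \<T> V lam \<mu> \<alpha> \<beta>i K \<tau> L f g u' p' u p\<close>[unfolded stabilized_scheme_def]
  note iter = \<open>two_parameter_iteration \<Omega> \<T> V lam \<mu> \<alpha> \<beta>i K \<tau> L \<gamma>\<^sub>1 \<gamma>\<^sub>2 f g u' p' us ps\<close>
    [unfolded two_parameter_iteration_def]
  note se = \<open>spectral_equivalence \<Omega> \<T> C\<^sub>1 C\<^sub>2\<close>
  note wis = \<open>weak_inf_sup \<Omega> \<T> V lam \<mu> \<eta> \<epsilon>\<close>
  note C1 = piecewise_C1_spaces[OF V]
  define m where "m = \<alpha>\<^sup>2 / (lam + 2 * \<mu> / real CARD('d))"
  have m: "m > 0" using pos by (auto simp: m_def intro!: divide_pos_pos add_pos_nonneg)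
  have L: "(\<gamma>\<^sub>1 - \<gamma>\<^sub>2) * L = \<omega> * m"
    using \<open>(\<gamma>\<^sub>1 - \<gamma>\<^sub>2) * L = \<omega> * (\<alpha>\<^sup>2 / (lam + 2 * \<mu> / real CARD('d)))\<close> by (simp add: m_def)
  then have "(\<gamma>\<^sub>1 - \<gamma>\<^sub>2) * L > 0" using m pos by simp
  then have Lpos: "L > 0" using gam by (simp add: zero_less_mult_iff)
  have C2: "C\<^sub>2 > 0" using se by (simp add: spectral_equivalence_def)
  have u: "u \<in> V" and p: "p \<in> Q_space \<Omega> \<T>" and mom: "momentum_equation \<Omega> V lam \<mu> \<alpha> f u p"
    using scheme by auto
  note scheme_q = scheme[THEN conjunct2, THEN conjunct2, THEN conjunct2, rule_format]
  note step_q = iter[THEN conjunct2, THEN conjunct2, THEN conjunct1, rule_format, THEN conjunct2, rule_format]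
  have usV: "us i \<in> V" and psQ: "ps i \<in> Q_space \<Omega> \<T>" for i
    using iter \<open>u' \<in> V\<close> \<open>p' \<in> Q_space \<Omega> \<T>\<close> by (cases "i = 0"; simp)+
  have euV: "eu i \<in> V" and epQ: "ep i \<in> Q_space \<Omega> \<T>" for i
    unfolding eu_def ep_def by (intro V_diff[OF V] Q_space_diff usV psQ u p)+
  \<comment> \<open>For positive \<open>i\<close> this is Step 2 of the method; for the initial
    guess it is the compatibility condition.\<close>
  have momi: "momentum_equation \<Omega> V lam \<mu> \<alpha> f (us i) (ps i)"
    if "i = 0 \<longrightarrow> momentum_equation \<Omega> V lam \<mu> \<alpha> f u' p'" for i
    using that iter by (cases "i = 0") (auto simp: momentum_equation_def)
  have eq: "a_form \<Omega> lam \<mu> (eu i) v = \<alpha> * ip \<Omega> (ep i) (divg v)"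
    if "i = 0 \<longrightarrow> momentum_equation \<Omega> V lam \<mu> \<alpha> f u' p'" "v \<in> V" for i v
    unfolding eu_def ep_def by (rule momentum_error_equation[OF V usV u psQ p momi[OF that(1)] mom that(2)])
  let ?E = "\<lambda>i. (L2_norm \<Omega> (ep i))\<^sup>2 + \<bar>1 - \<gamma>\<^sub>1\<bar> / (\<gamma>\<^sub>1 - \<gamma>\<^sub>2) * norm_Z_sq \<Omega> \<T> (ep i)"
  have contr: "?E i \<le> 1 / (1 + \<eta>\<^sup>2 / (\<omega> * (1 + 2 * \<theta>))) * ?E (i - 1)"
    if \<theta>: "is_theta_star \<gamma>\<^sub>1 \<omega> \<eta> \<epsilon> C\<^sub>2 \<theta>" and i: "i \<ge> 1" "i = 1 \<longrightarrow> momentum_equation \<Omega> V lam \<mu> \<alpha> f u' p'"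
    for \<theta> i
  proof -
    have i': "i = 0 \<longrightarrow> momentum_equation \<Omega> V lam \<mu> \<alpha> f u' p'"
      "i - 1 = 0 \<longrightarrow> momentum_equation \<Omega> V lam \<mu> \<alpha> f u' p'" using i by auto
    have "\<omega> * m * ip \<Omega> (ep i) (ep i) + (2 * \<gamma>\<^sub>1 - \<bar>1 - \<gamma>\<^sub>1\<bar>) * L * norm_Z_sq \<Omega> \<T> (ep i)
        + a_form \<Omega> lam \<mu> (eu i) (eu i)
      \<le> \<omega> * m * ip \<Omega> (ep (i - 1)) (ep (i - 1)) + \<bar>1 - \<gamma>\<^sub>1\<bar> * L * norm_Z_sq \<Omega> \<T> (ep (i - 1))"
    proof (rule error_energy_step[OF V pos(1,2,5,6,4) se _ _ epQ epQ euV euV eq[OF i'(1)] eq[OF i'(2)]])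
      \<comment> \<open>Here \<open>M\<close> is \<open>\<omega> * m\<close>, that is
        \<open>(\<gamma>\<^sub>1 - \<gamma>\<^sub>2) * L\<close>, and
        \<open>\<omega> \<ge> 1\<close> enters.\<close>
      show "\<alpha>\<^sup>2 / (lam + 2 * \<mu> / real CARD('d)) \<le> \<omega> * m"
        using m pos by (simp add: m_def[symmetric])
      show "\<beta>i * ip \<Omega> (ep i) (ep i) + \<omega> * m * (ip \<Omega> (ep i) (ep i) - ip \<Omega> (ep (i - 1)) (ep i))
          + \<gamma>\<^sub>1 * L * ip_Z \<Omega> \<T> (ep i) (ep i) - (\<gamma>\<^sub>1 - 1) * L * ip_Z \<Omega> \<T> (ep (i - 1)) (ep i)
          + \<tau> * ap_form \<Omega> K (ep i) (ep i) + \<alpha> * ip \<Omega> (divg (eu (i - 1))) (ep i) = 0"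
        using pressure_error_equation[OF p \<open>p' \<in> Q_space \<Omega> \<T>\<close> psQ[of i] psQ[of "i - 1"]
            C1[OF u] C1[OF \<open>u' \<in> V\<close>] C1[OF usV[of "i - 1"]] epQ[of i] \<open>\<tau> > 0\<close>
            scheme_q[OF epQ[of i]] step_q[OF i(1) epQ[of i]]]
        unfolding L[symmetric] ep_def eu_def .
      show "0 \<le> L" using Lpos by simp
    qed
    moreover have "sqrt m * (\<eta> * sqrt (ip \<Omega> (ep i) (ep i)) - \<epsilon> * sqrt (C\<^sub>2 * norm_Z_sq \<Omega> \<T> (ep i)))
        \<le> sqrt (a_form \<Omega> lam \<mu> (eu i) (eu i))"
      using inf_sup_lower_bound[OF V euV epQ pos(1,2,3,8) eq[OF i'(1)] wis se]
      using pos by (simp add: m_def real_sqrt_divide norm_A_def L2_norm_def)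
    ultimately show ?thesis
      unfolding L2_norm_sq using pos
      by (intro contraction_step[OF \<theta> gam \<open>\<omega> \<ge> 1\<close> \<open>\<epsilon> > 0\<close> C2 \<open>\<eta> > 0\<close> m L])
        (simp_all add: ip_nonneg norm_Z_sq_nonneg[OF se epQ] a_form_nonneg)
  qed
  obtain \<theta> where \<theta>: "is_theta_star \<gamma>\<^sub>1 \<omega> \<eta> \<epsilon> C\<^sub>2 \<theta>"
    using theta_star_exists[OF gam(1) \<open>\<omega> \<ge> 1\<close> \<open>\<epsilon> > 0\<close> C2] by blast
  define r where "r = 1 / (1 + \<eta>\<^sup>2 / (\<omega> * (1 + 2 * \<theta>)))"
  have "\<theta> > 0" using theta_star_pos[OF \<theta> gam(1) \<open>\<omega> \<ge> 1\<close> \<open>\<epsilon> > 0\<close> C2] .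
  then have "\<eta>\<^sup>2 / (\<omega> * (1 + 2 * \<theta>)) > 0" using pos by (intro divide_pos_pos mult_pos_pos) auto
  then have r: "0 \<le> r" "r < 1" by (auto simp: r_def)
  \<comment> \<open>The decay is counted from the first iterate: each step used leads to an index of
    at least 2, where \<open>contr\<close> asks for no compatibility of the initial data.\<close>
  have geo: "?E (Suc k) \<le> r ^ k * ?E 1" for k
  proof (induction k)
    case (Suc k)
    have "?E (Suc (Suc k)) \<le> r * ?E (Suc k)"
      using contr[OF \<theta>, of "Suc (Suc k)"] by (simp add: r_def)
    also have "\<dots> \<le> r * (r ^ k * ?E 1)" using Suc r by (intro mult_left_mono)
    finally show ?case by (simp add: mult_ac)
  qed simp
  have ep_le: "(L2_norm \<Omega> (ep i))\<^sup>2 \<le> ?E i" for i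
    using norm_Z_sq_nonneg[OF se epQ] gam by simp
  have lim: "(\<lambda>k. r ^ k * ?E 1) \<longlonglongrightarrow> 0"
    using r by (intro tendsto_mult_left_zero LIMSEQ_power_zero) auto
  have "(L2_norm \<Omega> (ep (Suc k)))\<^sup>2 \<le> r ^ k * ?E 1" for k
    by (rule order_trans[OF ep_le geo])
  then have "(\<lambda>k. (L2_norm \<Omega> (ep (Suc k)))\<^sup>2) \<longlonglongrightarrow> 0"
    by (intro tendsto_sandwich[OF _ _ tendsto_const lim] always_eventually allI zero_le_power2)
  from tendsto_real_sqrt[OF this] have "(\<lambda>k. L2_norm \<Omega> (ep (Suc k))) \<longlonglongrightarrow> 0"
    by (simp add: L2_norm_def ip_nonneg)
  then have lim_p: "(\<lambda>i. L2_norm \<Omega> (ep i)) \<longlonglongrightarrow> 0" by (rule LIMSEQ_imp_Suc)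
  \<comment> \<open>The momentum relation, tested with the displacement error itself, lets it
    inherit the convergence of the pressure error.\<close>
  have bound: "norm_A \<Omega> lam \<mu> (eu (Suc k)) \<le> sqrt m * L2_norm \<Omega> (ep (Suc k))" for k
    using a_form_energy_bound[OF piecewise_C1_spaces[OF V euV] Q_space_L2[OF epQ] pos(1,2)
        eq[OF _ euV], of "Suc k"]
    by (simp add: norm_A_def L2_norm_def m_def[symmetric] flip: real_sqrt_mult)
  have nonneg: "0 \<le> norm_A \<Omega> lam \<mu> (eu (Suc k))" for k
    using pos by (simp add: norm_A_def a_form_nonneg)
  have lim_b: "(\<lambda>k. sqrt m * L2_norm \<Omega> (ep (Suc k))) \<longlonglongrightarrow> 0"
    using lim_p by (intro tendsto_mult_right_zero LIMSEQ_Suc)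
  have "(\<lambda>k. norm_A \<Omega> lam \<mu> (eu (Suc k))) \<longlonglongrightarrow> 0"
    by (rule tendsto_sandwich[OF _ _ tendsto_const lim_b]) (simp_all only: nonneg bound eventually_True)
  then have lim_u: "(\<lambda>i. norm_A \<Omega> lam \<mu> (eu i)) \<longlonglongrightarrow> 0" by (rule LIMSEQ_imp_Suc)
  show ?thesis
    using lim_p lim_u \<theta> contr by (intro conjI exI allI impI)
qed

end
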